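(* All constructible simplicial $3$-balls are collapsible.
   Context: All complexes are finite. A simplicial $3$-ball is a simplicial complex whose underlying space is homeomorphic to the $3$-ball. Constructible: every simplex is constructible; a pure $d$-dimensional simplicial complex $C$ that is not a simplex is constructible iff $C=C_1\cup C_2$ with $C_1,C_2$ constructible $d$-complexes and $C_1\cap C_2$ a constructible $(d-1)$-complex. Collapse: an elementary collapse removes from a complex a pair of faces $(\sigma,\Sigma)$ with $\dim\Sigma=\dim\sigma+1$, $\sigma$ a proper face of $\Sigma$ and of no other face. A complex is collapsible if it can be reduced to a single vertex by a finite sequence of elementary collapses. *)

theory Defs
  imports "HOL-Analysis.Analysis"
begin

text \<open>Complexes are finite geometric simplicial complexes in a Euclidean space, as in the library's
  \<^const>\<open>simplicial_complex\<close>.  With that definition every nonempty complex contains the empty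
  face, which has affine dimension -1 and is the (-1)-dimensional simplex.\<close>

definition simplicial_3_ball :: "'a::euclidean_space set set \<Rightarrow> bool" where
  "simplicial_3_ball C \<longleftrightarrow>
     simplicial_complex C \<and> \<Union>C homeomorphic cball (0 :: real^3) 1"

definition pure_complex :: "int \<Rightarrow> 'a::euclidean_space set set \<Rightarrow> bool" where
  "pure_complex d C \<longleftrightarrow>
     simplicial_complex C \<and> C \<noteq> {} \<and>
     (\<forall>F\<in>C. (\<forall>S\<in>C. F face_of S \<longrightarrow> S = F) \<longrightarrow> aff_dim F = d)"

text \<open>The index \<open>d\<close> is the dimension of the complex.  As usual, the recursion
  bottoms out at the complex \<open>{{}}\<close>, the (-1)-simplex, so every nonempty finite set of
  points is a constructible 0-complex.\<close>

inductive constructible_dim :: "int \<Rightarrow> 'a::euclidean_space set set \<Rightarrow> bool" where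
  simplex: "d simplex S \<Longrightarrow> constructible_dim d {F. F face_of S}"
| union: "pure_complex d (C1 \<union> C2) \<Longrightarrow> constructible_dim d C1 \<Longrightarrow> constructible_dim d C2 \<Longrightarrow>
     constructible_dim (d - 1) (C1 \<inter> C2) \<Longrightarrow> constructible_dim d (C1 \<union> C2)"

definition constructible :: "'a::euclidean_space set set \<Rightarrow> bool" where
  "constructible C \<longleftrightarrow> (\<exists>d. constructible_dim d C)"

text \<open>The condition \<open>\<sigma> \<noteq> {}\<close> only rules out collapsing a vertex to the empty complex by removing
  it together with the empty face.\<close>

definition elementary_collapse ::
    "'a::euclidean_space set set \<Rightarrow> 'a set set \<Rightarrow> bool" where
  "elementary_collapse C D \<longleftrightarrow>
     (\<exists>\<sigma> \<Sigma>. \<sigma> \<in> C \<and> \<Sigma> \<in> C \<and> \<sigma> \<noteq> {} \<and> \<sigma> face_of \<Sigma> \<and> aff_dim \<Sigma> = aff_dim \<sigma> + 1 \<and>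
        (\<forall>T\<in>C. \<sigma> face_of T \<and> \<sigma> \<noteq> T \<longrightarrow> T = \<Sigma>) \<and>
        D = C - {\<sigma>, \<Sigma>})"

definition collapsible :: "'a::euclidean_space set set \<Rightarrow> bool" where
  "collapsible C \<longleftrightarrow> (\<exists>v. elementary_collapse\<^sup>*\<^sup>* C {{}, {v}})"

end

theory Submission
  imports Defs
begin

text \<open>A constructible ball \<open>C\<close> minus any facet collapses onto its boundary: if \<open>C = A \<union> B\<close> with
  interface \<open>D = A \<inter> B\<close> and the facet lies in \<open>A\<close>, then by induction \<open>A\<close> minus the facet collapses onto
  \<open>\<partial>A\<close>, next \<open>B\<close> collapses onto \<open>\<partial>B\<close> minus a facet \<open>R\<close> of \<open>D\<close>, and finally \<open>D\<close> minus \<open>R\<close> collapses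
  onto \<open>\<partial>D = D \<inter> \<partial>C\<close>.  Hence \<open>C\<close> collapses onto \<open>\<partial>C\<close> minus a triangle.  As \<open>\<partial>C\<close> is strongly connected
  with every edge in two triangles, all its remaining triangles can be collapsed away, which leaves a
  connected graph with the Euler characteristic of \<open>C\<close>, namely a tree.

  The combinatorial manifold properties used here (\<open>D\<close> is again a ball, \<open>\<partial>D = D \<inter> \<partial>C\<close>, \<open>\<partial>C\<close> is strongly
  connected) need only that every ridge lies in at most two facets: constructibility passes to
  links, and a constructible complex has no mod 2 homology in codimension one.  That hypothesis,
  the dimension, and the existence of a boundary triangle follow from the homeomorphism with the
  3-ball by invariance of domain.\<close>

section \<open>Facets, ridges and the boundary of an abstract constructible complex\<close>

section \<open>Abstract constructible complexes\<close>

definition down_closed :: "'v set set \<Rightarrow> bool" where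
  "down_closed K \<longleftrightarrow> (\<forall>F\<in>K. \<forall>G. G \<subseteq> F \<longrightarrow> G \<in> K)"

lemma down_closedD: "down_closed K \<Longrightarrow> F \<in> K \<Longrightarrow> G \<subseteq> F \<Longrightarrow> G \<in> K"
  unfolding down_closed_def by blast

text \<open>The index is the number of vertices of a facet, that is, the dimension plus one.\<close>

inductive abs_constructible :: "nat \<Rightarrow> 'v set set \<Rightarrow> bool" where
  abs_simplex: "finite S \<Longrightarrow> card S = n \<Longrightarrow> abs_constructible n (Pow S)"
| abs_union: "abs_constructible (Suc n) A \<Longrightarrow> abs_constructible (Suc n) B \<Longrightarrow>
    abs_constructible n (A \<inter> B) \<Longrightarrow> abs_constructible (Suc n) (A \<union> B)"

lemma abs_constructible_finite: "abs_constructible n K \<Longrightarrow> finite K"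
  by (induction rule: abs_constructible.induct) auto

lemma abs_constructible_finite_face: "abs_constructible n K \<Longrightarrow> F \<in> K \<Longrightarrow> finite F"
  by (induction rule: abs_constructible.induct) (auto intro: finite_subset)

lemma abs_constructible_down_closed: "abs_constructible n K \<Longrightarrow> down_closed K"
  unfolding down_closed_def by (induction rule: abs_constructible.induct) (blast+)

lemma abs_constructible_pure:
  "abs_constructible n K \<Longrightarrow> F \<in> K \<Longrightarrow> \<exists>G\<in>K. F \<subseteq> G \<and> card G = n"
  by (induction rule: abs_constructible.induct) blast+

lemma abs_constructible_card_le:
  assumes "abs_constructible n K" "F \<in> K" shows "card F \<le> n"
  using abs_constructible_pure[OF assms] abs_constructible_finite_face[OF assms(1)] card_mono by metis

lemma abs_constructible_empty: "abs_constructible n K \<Longrightarrow> {} \<in> K"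
  by (induction rule: abs_constructible.induct) auto

definition cofaces :: "'v set set \<Rightarrow> 'v set \<Rightarrow> 'v set set" where
  "cofaces K R = {F \<in> K. R \<subseteq> F \<and> card F = Suc (card R)}"

text \<open>Only the local half of the usual notion; strong connectivity is a consequence of
  constructibility, see \<open>abs_constructible_strongly_connected\<close>.\<close>

definition pseudomanifold :: "nat \<Rightarrow> 'v set set \<Rightarrow> bool" where
  "pseudomanifold n K \<longleftrightarrow> (\<forall>R\<in>K. Suc (card R) = n \<longrightarrow> card (cofaces K R) \<le> 2)"

text \<open>The form with \<open>Suc\<close> leaves a complex with \<open>n = 0\<close> without
  ridges, hence without boundary.\<close>

definition boundary_ridges :: "nat \<Rightarrow> 'v set set \<Rightarrow> 'v set set" where
  "boundary_ridges n K = {R \<in> K. Suc (card R) = n \<and> card (cofaces K R) = 1}"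

text \<open>As a subcomplex it is either empty or contains the empty face. So
  \<open>{} \<in> bd n K\<close> says that there is a boundary at all, which separates balls from
  spheres.\<close>

definition bd :: "nat \<Rightarrow> 'v set set \<Rightarrow> 'v set set" where
  "bd n K = {G. \<exists>R\<in>boundary_ridges n K. G \<subseteq> R}"

lemma finite_cofaces: "finite K \<Longrightarrow> finite (cofaces K R)"
  unfolding cofaces_def by auto

lemma card_cofaces_pos:
  assumes "abs_constructible n K" "R \<in> K" "Suc (card R) = n"
  shows "card (cofaces K R) \<ge> 1"
proof -
  obtain G where "G \<in> K" "R \<subseteq> G" "card G = n" using abs_constructible_pure[OF assms(1,2)] by blast
  then have "G \<in> cofaces K R" using assms by (auto simp: cofaces_def)
  then show ?thesis using finite_cofaces[OF abs_constructible_finite[OF assms(1)]]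
    by (metis One_nat_def Suc_leI card_gt_0_iff empty_iff)
qed

lemma pseudomanifold_subset:
  assumes "pseudomanifold n K" "L \<subseteq> K" "finite K" shows "pseudomanifold n L"
  unfolding pseudomanifold_def
proof (intro ballI impI)
  fix R assume "R \<in> L" "Suc (card R) = n"
  moreover have "card (cofaces L R) \<le> card (cofaces K R)"
    using assms finite_cofaces[of K R] by (intro card_mono) (auto simp: cofaces_def)
  ultimately show "card (cofaces L R) \<le> 2"
    using assms unfolding pseudomanifold_def by (metis order_trans subsetD)
qed

section \<open>Links\<close>

definition link :: "'v set \<Rightarrow> 'v set set \<Rightarrow> 'v set set" where
  "link F K = {G. G \<inter> F = {} \<and> G \<union> F \<in> K}"

lemma link_Un: "link F (A \<union> B) = link F A \<union> link F B"
  and link_Int: "link F (A \<inter> B) = link F A \<inter> link F B"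
  unfolding link_def by auto

lemma link_not_face: "down_closed K \<Longrightarrow> F \<notin> K \<Longrightarrow> link F K = {}"
  unfolding link_def down_closed_def by blast

text \<open>Links distribute over unions and intersections, so a decomposition of \<open>K\<close>
  induces one of the link of an interface face. If \<open>F\<close> lies in one part only, the other
  part contributes nothing.\<close>

lemma abs_constructible_link:
  "abs_constructible n K \<Longrightarrow> F \<in> K \<Longrightarrow> abs_constructible (n - card F) (link F K)"
proof (induction rule: abs_constructible.induct)
  case (abs_simplex S n)
  have "link F (Pow S) = Pow (S - F)" using abs_simplex unfolding link_def by auto
  moreover have "card (S - F) = n - card F"
    using abs_simplex by (auto simp: card_Diff_subset finite_subset)
  ultimately show ?case using abs_simplex by (metis abs_constructible.abs_simplex finite_Diff)
next
  case (abs_union n A B)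
  consider "F \<in> A \<inter> B" | "F \<in> A" "F \<notin> B" | "F \<in> B" "F \<notin> A" using abs_union by blast
  then show ?case
  proof cases
    case 1
    then have "card F \<le> n" using abs_union abs_constructible_card_le by blast
    \<comment> \<open>The bound on \<open>card F\<close> keeps the subtraction from truncating, so
      the index has the successor form that the union rule requires.\<close>
    then have e: "Suc n - card F = Suc (n - card F)" by simp
    show ?thesis unfolding e link_Un
      by (rule abs_constructible.abs_union) (use 1 abs_union e link_Int in \<open>auto simp flip: link_Int\<close>)
  next
    case 2
    then show ?thesis using abs_union link_not_face[OF abs_constructible_down_closed, of _ B F]
      by (auto simp: link_Un)
  next
    case 3
    then show ?thesis using abs_union link_not_face[OF abs_constructible_down_closed, of _ A F]
      by (auto simp: link_Un)
  qed
qed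

lemma card_link_face:
  assumes "abs_constructible n K" "G \<in> link F K"
  shows "card (G \<union> F) = card G + card F"
  using assms abs_constructible_finite_face[OF assms(1), of "G \<union> F"]
  by (auto simp: link_def intro!: card_Un_disjoint)

text \<open>Joining with \<open>F\<close> is a bijection that raises all cardinalities by
  \<open>card F\<close>, so it preserves incidence in codimension one.\<close>

lemma cofaces_link:
  assumes "abs_constructible n K" "G \<in> link F K"
  shows "card (cofaces (link F K) G) = card (cofaces K (G \<union> F))"
proof (rule bij_betw_same_card)
  have G: "G \<inter> F = {}" "G \<union> F \<in> K" using assms by (auto simp: link_def)
  note c = card_link_face[OF assms(1)]
  show "bij_betw (\<lambda>H. H \<union> F) (cofaces (link F K) G) (cofaces K (G \<union> F))"
  proof (rule bij_betw_byWitness[where f' = "\<lambda>H. H - F"])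
    show "\<forall>a\<in>cofaces (link F K) G. (a \<union> F) - F = a" by (auto simp: cofaces_def link_def)
    show "\<forall>a\<in>cofaces K (G \<union> F). (a - F) \<union> F = a" by (auto simp: cofaces_def)
    show "(\<lambda>H. H \<union> F) ` cofaces (link F K) G \<subseteq> cofaces K (G \<union> F)"
      using c c[OF assms(2)] by (auto simp: cofaces_def) (auto simp: link_def)
    show "(\<lambda>H. H - F) ` cofaces K (G \<union> F) \<subseteq> cofaces (link F K) G"
    proof clarify
      fix H assume H: "H \<in> cofaces K (G \<union> F)"
      then have HF: "H - F \<union> F = H" by (auto simp: cofaces_def)
      have l: "H - F \<in> link F K" using H HF by (auto simp: cofaces_def link_def)
      show "H - F \<in> cofaces (link F K) G"
        using H l c[OF l] c[OF assms(2)] G HF by (auto simp: cofaces_def)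
    qed
  qed
qed

lemma pseudomanifold_link:
  assumes "abs_constructible n K" "pseudomanifold n K" "F \<in> K"
  shows "pseudomanifold (n - card F) (link F K)"
  unfolding pseudomanifold_def
proof (intro ballI impI)
  fix G assume G: "G \<in> link F K" "Suc (card G) = n - card F"
  then have "G \<union> F \<in> K" "Suc (card (G \<union> F)) = n"
    using card_link_face[OF assms(1) G(1)] by (auto simp: link_def)
  then show "card (cofaces (link F K) G) \<le> 2"
    using assms(2) cofaces_link[OF assms(1) G(1)] unfolding pseudomanifold_def by auto
qed

lemma boundary_ridges_link:
  assumes "abs_constructible n K" "F \<in> K"
  shows "bij_betw (\<lambda>G. G \<union> F) (boundary_ridges (n - card F) (link F K))
    {R \<in> boundary_ridges n K. F \<subseteq> R}"
proof (rule bij_betw_byWitness[where f' = "\<lambda>H. H - F"])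
  note c = card_link_face[OF assms(1)] and d = cofaces_link[OF assms(1)]
  show "\<forall>a\<in>boundary_ridges (n - card F) (link F K). (a \<union> F) - F = a"
    by (auto simp: boundary_ridges_def link_def)
  show "\<forall>a\<in>{R \<in> boundary_ridges n K. F \<subseteq> R}. (a - F) \<union> F = a" by auto
  show "(\<lambda>H. H \<union> F) ` boundary_ridges (n - card F) (link F K) \<subseteq> {R \<in> boundary_ridges n K. F \<subseteq> R}"
    using c d by (auto simp: boundary_ridges_def) (auto simp: link_def)
  show "(\<lambda>H. H - F) ` {R \<in> boundary_ridges n K. F \<subseteq> R} \<subseteq> boundary_ridges (n - card F) (link F K)"
  proof clarify
    fix H assume H: "H \<in> boundary_ridges n K" "F \<subseteq> H"
    then have HF: "H - F \<union> F = H" by auto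
    have l: "H - F \<in> link F K" using H HF by (auto simp: boundary_ridges_def link_def)
    show "H - F \<in> boundary_ridges (n - card F) (link F K)"
      using H l c[OF l] d[OF l] HF by (auto simp: boundary_ridges_def)
  qed
qed

text \<open>This localizes: whether \<open>F\<close> is a boundary face becomes whether its link has
  a boundary at all.\<close>

lemma empty_in_bd_link:
  assumes "abs_constructible n K" "F \<in> K"
  shows "{} \<in> bd (n - card F) (link F K) \<longleftrightarrow> F \<in> bd n K"
  using bij_betw_imp_surj_on[OF boundary_ridges_link[OF assms]] unfolding bd_def by auto

section \<open>Codimension-one cycles and strong connectivity\<close>

section \<open>Chains modulo 2\<close>

text \<open>Chains over the field with two elements are sets of faces, added by symmetric
  difference. The empty face counts as the face below every vertex, so this is the augmented chain
  complex.\<close>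

definition chain_boundary :: "'v set set \<Rightarrow> 'v set set" where
  "chain_boundary Y = {R. finite R \<and> odd (card (cofaces Y R))}"

lemma odd_card_sym_diff:
  assumes "finite A" "finite B"
  shows "odd (card (sym_diff A B)) \<longleftrightarrow> odd (card A) \<noteq> odd (card B)"
proof -
  have "card (sym_diff A B) = card (A - B) + card (B - A)"
    using assms by (intro card_Un_disjoint) auto
  moreover have "card A = card (A - B) + card (A \<inter> B)" "card B = card (B - A) + card (A \<inter> B)"
    using assms card_Int_Diff[of A B] card_Int_Diff[of B A] by (auto simp: Int_commute)
  ultimately show ?thesis by auto
qed

lemma chain_boundary_sym_diff:
  assumes "finite Y" "finite Z"
  shows "chain_boundary (sym_diff Y Z) = sym_diff (chain_boundary Y) (chain_boundary Z)"
proof -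
  have "cofaces (sym_diff Y Z) R = sym_diff (cofaces Y R) (cofaces Z R)" for R
    unfolding cofaces_def by auto
  then show ?thesis unfolding chain_boundary_def
    using odd_card_sym_diff[OF finite_cofaces[OF assms(1)] finite_cofaces[OF assms(2)]] by auto
qed

lemma chain_boundary_empty [simp]: "chain_boundary {} = {}"
  by (auto simp: chain_boundary_def cofaces_def)

lemma chain_boundary_face: "R \<in> chain_boundary Y \<Longrightarrow> \<exists>F\<in>Y. R \<subseteq> F \<and> card F = Suc (card R)"
proof -
  assume "R \<in> chain_boundary Y"
  then have "cofaces Y R \<noteq> {}" unfolding chain_boundary_def by (metis card.empty even_zero mem_Collect_eq)
  then show ?thesis unfolding cofaces_def by auto
qed

lemma subset_codim1:
  assumes "finite F" "R \<subseteq> F" "card F = Suc (card R)"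
  shows "\<exists>x\<in>F. R = F - {x}"
proof -
  have "card (F - R) = 1" using assms by (simp add: card_Diff_subset finite_subset)
  then obtain x where "F - R = {x}" by (auto simp: card_1_singleton_iff)
  then show ?thesis using assms by auto
qed

lemma chain_boundary_single:
  assumes "finite F" shows "chain_boundary {F} = (\<lambda>x. F - {x}) ` F"
proof (intro equalityI subsetI)
  fix R assume "R \<in> chain_boundary {F}"
  then show "R \<in> (\<lambda>x. F - {x}) ` F"
    using chain_boundary_face[of R "{F}"] subset_codim1[OF assms, of R] by auto
next
  fix R assume "R \<in> (\<lambda>x. F - {x}) ` F"
  then obtain x where x: "x \<in> F" "R = F - {x}" by auto
  then have "cofaces {F} R = {F}" using card_Suc_Diff1[OF assms x(1)] by (auto simp: cofaces_def)
  then show "R \<in> chain_boundary {F}" using x assms by (auto simp: chain_boundary_def)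
qed

lemma cofaces_codim2:
  assumes "finite F" "x \<in> F" "y \<in> F" "x \<noteq> y" "X \<subseteq> (\<lambda>x. F - {x}) ` F"
  shows "cofaces X (F - {x, y}) = X \<inter> {F - {x}, F - {y}}"
proof -
  have c: "card (F - {x, y}) = card F - 2" "card F \<ge> 2"
    using assms by (auto simp: card_Diff_subset) (metis card_2_iff card_mono empty_subsetI insert_subset)
  show ?thesis unfolding cofaces_def using assms c by (auto simp: card_Diff_singleton)
qed

text \<open>By linearity a single face \<open>F\<close> suffices, and there each face
  \<open>F - {x, y}\<close> lies in exactly the two facets \<open>F - {x}\<close> and
  \<open>F - {y}\<close> of \<open>F\<close>.\<close>

lemma chain_boundary_boundary:
  assumes "finite Y" "\<And>F. F \<in> Y \<Longrightarrow> finite F"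
  shows "finite (chain_boundary Y) \<and> chain_boundary (chain_boundary Y) = {}"
  using assms
proof (induction Y rule: finite_induct)
  case empty
  then show ?case by simp
next
  case (insert F Y)
  have fF: "finite F" using insert by auto
  have b: "chain_boundary (chain_boundary {F}) = {}"
  proof (rule ccontr)
    assume "\<not> ?thesis"
    then obtain R where R: "R \<in> chain_boundary (chain_boundary {F})" by auto
    then obtain x where x: "x \<in> F" "R \<subseteq> F - {x}" "card (F - {x}) = Suc (card R)"
      using chain_boundary_face[OF R] chain_boundary_single[OF fF] by auto
    then obtain y where y: "y \<in> F - {x}" "R = F - {x} - {y}"
      using subset_codim1[of "F - {x}" R] fF by auto
    then have Re: "R = F - {x, y}" by auto
    have "cofaces (chain_boundary {F}) R = {F - {x}, F - {y}}"
      unfolding Re using cofaces_codim2[OF fF, of x y "chain_boundary {F}"] x y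
        chain_boundary_single[OF fF] by auto
    moreover have "F - {x} \<noteq> F - {y}" using x y by auto
    ultimately have "card (cofaces (chain_boundary {F}) R) = 2" by auto
    then show False using R unfolding chain_boundary_def by auto
  qed
  have f: "finite (chain_boundary {F})" by (simp add: chain_boundary_single[OF fF] fF)
  have "insert F Y = sym_diff {F} Y" using insert by auto
  then have "chain_boundary (insert F Y) = sym_diff (chain_boundary {F}) (chain_boundary Y)"
    using chain_boundary_sym_diff[of "{F}" Y] insert by simp
  moreover have IH: "finite (chain_boundary Y)" "chain_boundary (chain_boundary Y) = {}"
    using insert by simp_all
  ultimately show ?case
    using f b chain_boundary_sym_diff[OF f IH(1)] by simp
qed

text \<open>The decomposition of \<open>X\<close> is the Mayer--Vietoris argument, with reduced homology: for \<open>n = 1\<close>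
  the only ridge is the empty face.\<close>

lemma abs_constructible_cycle_bounds:
  assumes "abs_constructible n K" "X \<subseteq> {R \<in> K. Suc (card R) = n}" "chain_boundary X = {}"
  shows "\<exists>Y\<subseteq>{F \<in> K. card F = n}. chain_boundary Y = X"
  using assms
proof (induction arbitrary: X rule: abs_constructible.induct)
  case (abs_simplex S n)
  note S = chain_boundary_single[OF abs_simplex(1)]
  have X: "X \<subseteq> (\<lambda>x. S - {x}) ` S"
  proof
    fix R assume "R \<in> X"
    then have "R \<subseteq> S" "card S = Suc (card R)" using abs_simplex(2,3) by auto
    then show "R \<in> (\<lambda>x. S - {x}) ` S" using subset_codim1[OF abs_simplex(1), of R] by auto
  qed
  show ?case
  proof (cases "X = {}")
    case True
    then show ?thesis by (intro exI[of _ "{}"]) auto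
  next
    case False
    have "X = (\<lambda>x. S - {x}) ` S"
    proof (rule ccontr)
      assume "X \<noteq> (\<lambda>x. S - {x}) ` S"
      then obtain y where y: "y \<in> S" "S - {y} \<notin> X" using X by auto
      obtain x where x: "x \<in> S" "S - {x} \<in> X" using X False by auto
      \<comment> \<open>Of the two facets of \<open>S\<close> above \<open>S - {x, y}\<close> only
        one is in \<open>X\<close>, so this face survives in the boundary. Hence a nonzero cycle
        consists of all facets of \<open>S\<close>.\<close>
      have "cofaces X (S - {x, y}) = {S - {x}}"
        using cofaces_codim2[of S x y X] X x y abs_simplex by auto
      then have "S - {x, y} \<in> chain_boundary X" using abs_simplex by (auto simp: chain_boundary_def)
      then show False using abs_simplex by auto
    qed
    then show ?thesis using S abs_simplex by (intro exI[of _ "{S}"]) auto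
  qed
next
  case (abs_union n A B)
  have fin: "finite A" "finite B" using abs_union abs_constructible_finite by auto
  have ff: "\<And>F. F \<in> A \<Longrightarrow> finite F" "\<And>F. F \<in> B \<Longrightarrow> finite F"
    using abs_union abs_constructible_finite_face by auto
  have dc: "down_closed A" "down_closed B" using abs_union abs_constructible_down_closed by auto
  define XA where "XA = X \<inter> A"
  \<comment> \<open>Ridges in both parts are assigned to \<open>A\<close>, which makes the splitting
    of \<open>X\<close> disjoint.\<close>
  define XB where "XB = X - A"
  have sub: "XA \<subseteq> {R \<in> A. card R = n}" "XB \<subseteq> {R \<in> B. card R = n}"
    using abs_union by (auto simp: XA_def XB_def)
  have fX: "finite XA" "finite XB" using sub fin by (auto intro: finite_subset)
  have Xe: "X = sym_diff XA XB" by (auto simp: XA_def XB_def)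
  then have "sym_diff (chain_boundary XA) (chain_boundary XB) = {}"
    using chain_boundary_sym_diff[OF fX] abs_union by simp
  then have eq: "chain_boundary XA = chain_boundary XB" by auto
  have bs: "chain_boundary XA \<subseteq> {R \<in> A \<inter> B. Suc (card R) = n}"
  proof
    fix R assume R: "R \<in> chain_boundary XA"
    then obtain F G where "F \<in> XA" "R \<subseteq> F" "card F = Suc (card R)" "G \<in> XB" "R \<subseteq> G"
      using chain_boundary_face[of R] eq by metis
    then show "R \<in> {R \<in> A \<inter> B. Suc (card R) = n}"
      using sub dc by (auto simp: down_closed_def)
  qed
  have "chain_boundary (chain_boundary XA) = {}"
    using chain_boundary_boundary[OF fX(1)] ff sub by auto
  \<comment> \<open>The common boundary of \<open>XA\<close> and \<open>XB\<close> is a cycle in the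
    interface, of codimension one there. A chain \<open>W\<close> bounded by it completes both
    \<open>XA\<close> and \<open>XB\<close> to cycles in their parts.\<close>
  then obtain W where W: "W \<subseteq> {F \<in> A \<inter> B. card F = n}" "chain_boundary W = chain_boundary XA"
    using abs_union.IH(3)[OF bs] by auto
  have fW: "finite W" using W fin by (auto intro: finite_subset)
  have "sym_diff XA W \<subseteq> {R \<in> A. Suc (card R) = Suc n}" using sub W by auto
  moreover have "chain_boundary (sym_diff XA W) = {}"
    using chain_boundary_sym_diff[OF fX(1) fW] W by auto
  ultimately obtain YA where YA: "YA \<subseteq> {F \<in> A. card F = Suc n}" "chain_boundary YA = sym_diff XA W"
    using abs_union.IH(1)[of "sym_diff XA W"] by auto
  have "sym_diff XB W \<subseteq> {R \<in> B. Suc (card R) = Suc n}" using sub W by auto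
  moreover have "chain_boundary (sym_diff XB W) = {}"
    using chain_boundary_sym_diff[OF fX(2) fW] W eq by auto
  ultimately obtain YB where YB: "YB \<subseteq> {F \<in> B. card F = Suc n}" "chain_boundary YB = sym_diff XB W"
    using abs_union.IH(2)[of "sym_diff XB W"] by auto
  have "finite YA" "finite YB" using YA YB fin by (auto intro: finite_subset)
  \<comment> \<open>The two copies of \<open>W\<close> cancel modulo 2.\<close>
  then have "chain_boundary (sym_diff YA YB) = X"
    using chain_boundary_sym_diff[of YA YB] YA YB Xe by auto
  then show ?case using YA YB by (intro exI[of _ "sym_diff YA YB"]) auto
qed

text \<open>Connectivity is phrased by adjacency-closed sets \<open>Y\<close> instead of paths of
  facets. Each part is uniform by induction, and a facet of the interface has a coface in each part,
  which forces the two parts to agree.\<close>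

lemma abs_constructible_strongly_connected:
  assumes "abs_constructible n K"
    "\<And>R F G. R \<in> K \<Longrightarrow> Suc (card R) = n \<Longrightarrow> F \<in> cofaces K R \<Longrightarrow> G \<in> cofaces K R \<Longrightarrow> F \<in> Y \<Longrightarrow> G \<in> Y"
  shows "(\<forall>F\<in>K. card F = n \<longrightarrow> F \<in> Y) \<or> (\<forall>F\<in>K. card F = n \<longrightarrow> F \<notin> Y)"
  using assms
proof (induction rule: abs_constructible.induct)
  case (abs_simplex S n)
  have "F = S" if "F \<subseteq> S" "card F = n" for F using that abs_simplex(1,2) card_subset_eq[of S F] by simp
  then show ?case by auto
next
  case (abs_union n A B)
  have a: "(\<forall>F\<in>A. card F = Suc n \<longrightarrow> F \<in> Y) \<or> (\<forall>F\<in>A. card F = Suc n \<longrightarrow> F \<notin> Y)"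
    by (rule abs_union.IH) (use abs_union.prems in \<open>fastforce simp: cofaces_def\<close>)
  have b: "(\<forall>F\<in>B. card F = Suc n \<longrightarrow> F \<in> Y) \<or> (\<forall>F\<in>B. card F = Suc n \<longrightarrow> F \<notin> Y)"
    by (rule abs_union.IH) (use abs_union.prems in \<open>fastforce simp: cofaces_def\<close>)
  obtain R where R: "R \<in> A \<inter> B" "card R = n"
    using abs_constructible_empty abs_constructible_pure abs_union.hyps(3) by blast
  obtain F where F: "F \<in> A" "R \<subseteq> F" "card F = Suc n" using R abs_constructible_pure abs_union.hyps(1,2) by blast
  obtain G where G: "G \<in> B" "R \<subseteq> G" "card G = Suc n" using R abs_constructible_pure abs_union.hyps(1,2) by blast
  have "F \<in> cofaces (A \<union> B) R" "G \<in> cofaces (A \<union> B) R" using F G R by (auto simp: cofaces_def)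
  then have "F \<in> Y \<longleftrightarrow> G \<in> Y" using abs_union.prems[of R F G] abs_union.prems[of R G F] R by auto
  then show ?case using a b F G by auto
qed

section \<open>The boundary is closed and connected\<close>

section \<open>Boundary ridges\<close>

text \<open>The interface has a vertex but no edge, so gluing adds the edge numbers while it loses
  at least one vertex.\<close>

lemma card_vertices_le_edges:
  assumes "abs_constructible n K" "n = 2"
  shows "card {F \<in> K. card F = 1} \<le> Suc (card {F \<in> K. card F = 2})"
  using assms
proof (induction rule: abs_constructible.induct)
  case (abs_simplex S n)
  have "{F \<in> Pow S. card F = k} = {F. F \<subseteq> S \<and> card F = k}" for k by auto
  then show ?case using n_subsets[OF abs_simplex(1)] abs_simplex by simp
next
  case (abs_union n A B)
  have n: "n = 1" using abs_union by simp
  have fin: "finite A" "finite B" using abs_union.hyps abs_constructible_finite by auto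
  have u: "{F \<in> A \<union> B. card F = k} = {F \<in> A. card F = k} \<union> {F \<in> B. card F = k}"
    and i: "{F \<in> A \<inter> B. card F = k} = {F \<in> A. card F = k} \<inter> {F \<in> B. card F = k}" for k by auto
  have s: "card {F \<in> A \<union> B. card F = k} + card {F \<in> A \<inter> B. card F = k}
      = card {F \<in> A. card F = k} + card {F \<in> B. card F = k}" for k
    unfolding u i using fin by (intro card_Un_Int[symmetric]) auto
  have "{F \<in> A \<inter> B. card F = 2} = {}"
    using abs_constructible_card_le[OF abs_union.hyps(3)] n by fastforce
  then have "card {F \<in> A \<inter> B. card F = 2} = 0" by (simp only: card.empty)
  then have e: "card {F \<in> A \<union> B. card F = 2} = card {F \<in> A. card F = 2} + card {F \<in> B. card F = 2}"
    using s[of 2] by linarith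
  obtain v where "v \<in> A \<inter> B" "card v = 1"
    using abs_constructible_empty abs_constructible_pure abs_union.hyps(3) n by blast
  then have "{F \<in> A \<inter> B. card F = 1} \<noteq> {}" by auto
  moreover have "finite {F \<in> A \<inter> B. card F = 1}" using fin by simp
  ultimately have "card {F \<in> A \<inter> B. card F = 1} > 0" by (simp only: card_gt_0_iff simp_thms)
  then show ?case using abs_union.IH(1,2) n s[of 1] e by linarith
qed

text \<open>The handshake lemma: vertices and edges are faces of cardinality 1 and 2, so the cofaces
  of a vertex are its edges.\<close>

lemma sum_vertex_degrees:
  assumes K: "finite K" "down_closed K"
  shows "(\<Sum>v | v \<in> K \<and> card v = 1. card (cofaces K v)) = 2 * card {F \<in> K. card F = 2}"
proof -
  define V where "V = {F \<in> K. card F = 1}"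
  define E where "E = {F \<in> K. card F = 2}"
  have fin: "finite V" "finite E" using K by (auto simp: V_def E_def)
  have cE: "{F \<in> E. v \<subseteq> F} = cofaces K v" if "v \<in> V" for v
    using that by (auto simp: V_def E_def cofaces_def)
  have "card {v \<in> V. v \<subseteq> F} = 2" if F: "F \<in> E" for F
  proof -
    have fF: "finite F" using F card.infinite by (fastforce simp: E_def)
    have "{v \<in> V. v \<subseteq> F} = {v. v \<subseteq> F \<and> card v = 1}"
      using F down_closedD[OF K(2)] by (auto simp: V_def E_def)
    then show ?thesis using n_subsets[OF fF, of 1] F by (simp add: E_def)
  qed
  then have "(\<Sum>v\<in>V. card (cofaces K v)) = 2 * card E"
    using sum_multicount[OF fin, of "(\<subseteq>)" 2] cE by (simp add: mult.commute)
  then show ?thesis unfolding V_def E_def .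
qed

text \<open>The graph is a path or a cycle. All degrees are 1 or 2, so the handshake lemma makes the
  number of leaves even, and the bound on vertices by edges makes it at most 2.\<close>

lemma card_boundary_ridges_graph:
  assumes "abs_constructible 2 K" "pseudomanifold 2 K"
  shows "card (boundary_ridges 2 K) = 0 \<or> card (boundary_ridges 2 K) = 2"
proof -
  define V where "V = {F \<in> K. card F = 1}"
  define E where "E = {F \<in> K. card F = 2}"
  define V1 where "V1 = boundary_ridges 2 K"
  have fK: "finite K" using assms abs_constructible_finite by auto
  have fin: "finite V" "finite E" "finite V1"
    using fK by (auto simp: V_def E_def V1_def boundary_ridges_def)
  have "(\<Sum>v\<in>V. card (cofaces K v)) = 2 * card E"
    using sum_vertex_degrees[OF fK abs_constructible_down_closed[OF assms(1)]] by (simp add: V_def E_def)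
  moreover have "(\<Sum>v\<in>V. card (cofaces K v)) = (\<Sum>v\<in>V1. 1) + (\<Sum>v\<in>V - V1. 2)"
  proof -
    have sub: "V1 \<subseteq> V" by (auto simp: V1_def V_def boundary_ridges_def)
    have "card (cofaces K v) = 2" if "v \<in> V - V1" for v
      using that card_cofaces_pos[OF assms(1), of v] assms(2)
      unfolding pseudomanifold_def V_def V1_def boundary_ridges_def by fastforce
    moreover have "card (cofaces K v) = 1" if "v \<in> V1" for v
      using that by (auto simp: V1_def boundary_ridges_def)
    ultimately show ?thesis using sum.subset_diff[OF sub fin(1), of "\<lambda>v. card (cofaces K v)"] by simp
  qed
  moreover have "card V = card V1 + card (V - V1)"
  proof -
    have "V1 \<subseteq> V" by (auto simp: V1_def V_def boundary_ridges_def)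
    then show ?thesis using fin card_mono[OF fin(1)] by (simp add: card_Diff_subset)
  qed
  moreover have "card V \<le> Suc (card E)"
    using card_vertices_le_edges[OF assms(1)] by (simp add: V_def E_def)
  ultimately have "card V1 + 2 * card (V - V1) = 2 * card E" "card V1 + card (V - V1) \<le> Suc (card E)"
    by simp_all
  then have "even (card V1)" "card V1 \<le> 2" by presburger+
  then show ?thesis unfolding V1_def by presburger
qed

text \<open>The link of \<open>e\<close> is a constructible graph whose leaves correspond to the
  boundary ridges through \<open>e\<close>.\<close>

lemma card_boundary_ridges_codim2:
  assumes "abs_constructible n K" "pseudomanifold n K" "e \<in> K" "Suc (Suc (card e)) = n"
  shows "card {R \<in> boundary_ridges n K. e \<subseteq> R} = 0 \<or> card {R \<in> boundary_ridges n K. e \<subseteq> R} = 2"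
proof -
  have "n - card e = 2" using assms by simp
  then show ?thesis
    using bij_betw_same_card[OF boundary_ridges_link[OF assms(1,3)]]
      card_boundary_ridges_graph[of "link e K"] abs_constructible_link[OF assms(1,3)]
      pseudomanifold_link[OF assms(1,2,3)] by simp
qed

lemma boundary_ridges_codim2_cases:
  assumes "abs_constructible n K" "pseudomanifold n K" "Suc (Suc (card e)) = n"
    "R \<in> boundary_ridges n K" "e \<subseteq> R"
  obtains R' where "R' \<noteq> R" "{R \<in> boundary_ridges n K. e \<subseteq> R} = {R, R'}"
proof -
  have "e \<in> K" using down_closedD[OF abs_constructible_down_closed[OF assms(1)] _ assms(5)] assms(4)
    by (auto simp: boundary_ridges_def)
  moreover have "finite {R \<in> boundary_ridges n K. e \<subseteq> R}"
    using abs_constructible_finite[OF assms(1)] by (auto simp: boundary_ridges_def)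
  ultimately have "card {R \<in> boundary_ridges n K. e \<subseteq> R} = 2"
    using card_boundary_ridges_codim2[OF assms(1,2) _ assms(3)] assms(4,5) by fastforce
  then obtain x y where "x \<noteq> y" "{R \<in> boundary_ridges n K. e \<subseteq> R} = {x, y}"
    by (meson card_2_iff)
  then show ?thesis using that assms(4,5) by (metis (no_types, lifting) doubleton_eq_iff insertE mem_Collect_eq singletonD)
qed

text \<open>A set of boundary ridges closed under adjacency is a cycle, so it bounds a set of facets; that set is
  closed under adjacency as well, hence contains no facet or all of them.\<close>

lemma boundary_ridges_connected:
  assumes K: "abs_constructible n K" "pseudomanifold n K"
    and X: "X \<subseteq> boundary_ridges n K"
    and cyc: "\<And>e. e \<in> K \<Longrightarrow> Suc (Suc (card e)) = n \<Longrightarrow> even (card (cofaces X e))"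
  shows "X = {} \<or> X = boundary_ridges n K"
proof -
  have dc: "down_closed K" using K abs_constructible_down_closed by auto
  have "chain_boundary X = {}"
  proof (rule ccontr)
    assume "chain_boundary X \<noteq> {}"
    then obtain e where e: "e \<in> chain_boundary X" by auto
    then obtain F where F: "F \<in> X" "e \<subseteq> F" "card F = Suc (card e)" using chain_boundary_face by blast
    then have "e \<in> K" "Suc (Suc (card e)) = n" using X dc by (auto simp: boundary_ridges_def down_closed_def)
    then show False using cyc e by (auto simp: chain_boundary_def)
  qed
  moreover have "X \<subseteq> {R \<in> K. Suc (card R) = n}" using X by (auto simp: boundary_ridges_def)
  ultimately obtain Y where Y: "Y \<subseteq> {F \<in> K. card F = n}" "chain_boundary Y = X"
    using abs_constructible_cycle_bounds[OF K(1)] by blast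
  have fin: "finite K" using K abs_constructible_finite by auto
  have cY: "cofaces Y R = cofaces K R \<inter> Y" for R using Y by (auto simp: cofaces_def)
  have "(\<forall>F\<in>K. card F = n \<longrightarrow> F \<in> Y) \<or> (\<forall>F\<in>K. card F = n \<longrightarrow> F \<notin> Y)"
  proof (rule abs_constructible_strongly_connected[OF K(1)])
    fix R F G assume R: "R \<in> K" "Suc (card R) = n" and F: "F \<in> cofaces K R" "G \<in> cofaces K R" "F \<in> Y"
    show "G \<in> Y"
    proof (rule ccontr)
      assume G: "G \<notin> Y"
      have "card {F, G} \<le> card (cofaces K R)" using F finite_cofaces[OF fin] by (intro card_mono) auto
      moreover have "card (cofaces K R) \<le> 2" using R K(2) by (auto simp: pseudomanifold_def)
      moreover have "F \<noteq> G" using F(3) G by auto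
      ultimately have "card (cofaces K R) = 2" "F \<noteq> G" by auto
      then have "cofaces K R = {F, G}" using F finite_cofaces[OF fin, of R]
        by (metis (no_types, lifting) card_2_iff card_subset_eq empty_subsetI insert_subset)
      \<comment> \<open>Now \<open>R\<close> is in the boundary of \<open>Y\<close>, which is
        \<open>X\<close>, so it would be a boundary ridge despite its two cofaces.\<close>
      then have "cofaces Y R = {F}" using cY F G by auto
      then have "R \<in> chain_boundary Y" using R K(1) abs_constructible_finite_face by (auto simp: chain_boundary_def)
      then show False using Y X \<open>card (cofaces K R) = 2\<close> by (auto simp: boundary_ridges_def)
    qed
  qed
  then show ?thesis
  proof
    assume "\<forall>F\<in>K. card F = n \<longrightarrow> F \<notin> Y"
    then have "Y = {}" using Y by auto
    then show ?thesis using Y by auto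
  next
    assume "\<forall>F\<in>K. card F = n \<longrightarrow> F \<in> Y"
    then have "cofaces Y R = cofaces K R" if "R \<in> boundary_ridges n K" for R
      using that unfolding cY by (auto simp: cofaces_def boundary_ridges_def)
    then have "boundary_ridges n K \<subseteq> chain_boundary Y"
      using abs_constructible_finite_face[OF K(1)] by (auto simp: chain_boundary_def boundary_ridges_def)
    then show ?thesis using X Y by auto
  qed
qed

section \<open>The interface as a ball of one dimension less\<close>

section \<open>Decompositions along an interface\<close>

text \<open>The ridge condition is imposed on the union alone; the parts inherit it, and for the
  interface it is derived in \<open>pm_interface\<close>.\<close>

locale constructible_decomposition =
  fixes n :: nat and A B :: "'v set set"
  assumes A: "abs_constructible (Suc n) A" and B: "abs_constructible (Suc n) B"
    and D: "abs_constructible n (A \<inter> B)" and pm: "pseudomanifold (Suc n) (A \<union> B)"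
begin

lemma swap: "constructible_decomposition n B A"
  using A B D pm by unfold_locales (simp_all add: Un_commute Int_commute)

lemma union: "abs_constructible (Suc n) (A \<union> B)"
  by (rule abs_union[OF A B D])

lemma pm_left: "pseudomanifold (Suc n) A"
  using pseudomanifold_subset[OF pm, of A] abs_constructible_finite[OF union] by auto

lemma pm_right: "pseudomanifold (Suc n) B"
  by (rule constructible_decomposition.pm_left[OF swap])

lemma down_left: "F \<in> A \<Longrightarrow> G \<subseteq> F \<Longrightarrow> G \<in> A"
  and down_right: "F \<in> B \<Longrightarrow> G \<subseteq> F \<Longrightarrow> G \<in> B"
  using down_closedD[OF abs_constructible_down_closed[OF A]]
    down_closedD[OF abs_constructible_down_closed[OF B]] by blast+

text \<open>Purity gives \<open>R\<close> a coface in each part, and no coface lies in both, since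
  interface faces have at most \<open>n\<close> vertices. At most two are available, so there is
  exactly one on each side.\<close>

lemma card_interface_facet:
  assumes "R \<in> A" "R \<in> B" "card R = n"
  shows "card (cofaces A R) = 1" "card (cofaces (A \<union> B) R) = 2"
proof -
  have "F \<notin> B" if "F \<in> cofaces A R" for F
    using that abs_constructible_card_le[OF D, of F] assms(3) by (auto simp: cofaces_def)
  then have disj: "cofaces A R \<inter> cofaces B R = {}" by (auto simp: cofaces_def)
  have eq: "cofaces (A \<union> B) R = cofaces A R \<union> cofaces B R" by (auto simp: cofaces_def)
  have "card (cofaces (A \<union> B) R) = card (cofaces A R) + card (cofaces B R)"
    unfolding eq using disj A B abs_constructible_finite
    by (intro card_Un_disjoint) (auto intro: finite_cofaces)
  moreover have "card (cofaces A R) \<ge> 1" "card (cofaces B R) \<ge> 1"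
    using card_cofaces_pos[OF A] card_cofaces_pos[OF B] assms by auto
  moreover have "card (cofaces (A \<union> B) R) \<le> 2" using pm assms by (auto simp: pseudomanifold_def)
  ultimately show "card (cofaces A R) = 1" "card (cofaces (A \<union> B) R) = 2" by linarith+
qed

lemma interface_facets_subset: "{R \<in> A \<inter> B. card R = n} \<subseteq> boundary_ridges (Suc n) A"
  using card_interface_facet by (auto simp: boundary_ridges_def)

lemma interface_subset_bd: "A \<inter> B \<subseteq> bd (Suc n) A"
  using abs_constructible_pure[OF D] interface_facets_subset unfolding bd_def by blast

text \<open>Interface facets are boundary ridges of \<open>A\<close>, and at most two of those share
  a face of codimension one.\<close>

lemma pm_interface: "pseudomanifold n (A \<inter> B)"
  unfolding pseudomanifold_def
proof (intro ballI impI)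
  fix e assume e: "e \<in> A \<inter> B" "Suc (card e) = n"
  have "finite {R \<in> boundary_ridges (Suc n) A. e \<subseteq> R}"
    using abs_constructible_finite[OF A] by (auto simp: boundary_ridges_def)
  moreover have "cofaces (A \<inter> B) e \<subseteq> {R \<in> boundary_ridges (Suc n) A. e \<subseteq> R}"
    using e interface_facets_subset by (auto simp: cofaces_def)
  ultimately have "card (cofaces (A \<inter> B) e) \<le> card {R \<in> boundary_ridges (Suc n) A. e \<subseteq> R}"
    by (rule card_mono)
  then show "card (cofaces (A \<inter> B) e) \<le> 2"
    using card_boundary_ridges_codim2[OF A pm_left, of e] e by auto
qed

lemma boundary_ridge_union_left:
  assumes "R \<in> A" "R \<notin> B"
  shows "R \<in> boundary_ridges (Suc n) (A \<union> B) \<longleftrightarrow> R \<in> boundary_ridges (Suc n) A"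
proof -
  have "cofaces (A \<union> B) R = cofaces A R" using assms down_right by (auto simp: cofaces_def)
  then show ?thesis using assms by (auto simp: boundary_ridges_def)
qed

lemma boundary_ridge_union_right:
  assumes "R \<in> B" "R \<notin> A"
  shows "R \<in> boundary_ridges (Suc n) (A \<union> B) \<longleftrightarrow> R \<in> boundary_ridges (Suc n) B"
  using constructible_decomposition.boundary_ridge_union_left[OF swap] assms by (simp add: Un_commute)

lemma boundary_ridge_union_not_interface:
  "R \<in> boundary_ridges (Suc n) (A \<union> B) \<Longrightarrow> R \<notin> A \<inter> B"
  using card_interface_facet(2)[of R] by (auto simp: boundary_ridges_def)

text \<open>If \<open>e\<close> lies in a single interface facet \<open>R\<close>, then the second
  boundary ridge \<open>R'\<close> of \<open>A\<close> through \<open>e\<close> is not in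
  \<open>B\<close>, so it remains a boundary ridge of the union.\<close>

lemma bd_interface_subset: "bd n (A \<inter> B) \<subseteq> bd (Suc n) (A \<union> B)"
proof
  fix F assume "F \<in> bd n (A \<inter> B)"
  then obtain e where e: "e \<in> A \<inter> B" "Suc (card e) = n" "card (cofaces (A \<inter> B) e) = 1" "F \<subseteq> e"
    by (auto simp: bd_def boundary_ridges_def)
  then obtain R where R: "cofaces (A \<inter> B) e = {R}" by (auto simp: card_1_singleton_iff)
  then have "R \<in> cofaces (A \<inter> B) e" by simp
  then have R': "R \<in> boundary_ridges (Suc n) A" "e \<subseteq> R"
    using e interface_facets_subset by (auto simp: cofaces_def)
  obtain R' where R2: "R' \<noteq> R" "{R \<in> boundary_ridges (Suc n) A. e \<subseteq> R} = {R, R'}"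
    using boundary_ridges_codim2_cases[OF A pm_left _ R'] e by auto
  then have m: "R' \<in> boundary_ridges (Suc n) A" "e \<subseteq> R'" by blast+
  have "R' \<notin> B"
  proof
    assume "R' \<in> B"
    then have "R' \<in> cofaces (A \<inter> B) e" using m e by (auto simp: cofaces_def boundary_ridges_def)
    then show False using R R2 by auto
  qed
  then have "R' \<in> boundary_ridges (Suc n) (A \<union> B)"
    using m boundary_ridge_union_left by (auto simp: boundary_ridges_def)
  then show "F \<in> bd (Suc n) (A \<union> B)" using m e by (auto simp: bd_def)
qed

text \<open>If the interface has no boundary, then it is a nonempty cycle in the connected boundary of \<open>A\<close>.\<close>

lemma interface_closed:
  assumes "{} \<notin> bd n (A \<inter> B)"
  shows "boundary_ridges (Suc n) A = {R \<in> A \<inter> B. card R = n}"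
proof -
  define X where "X = {R \<in> A \<inter> B. card R = n}"
  have "even (card (cofaces X e))" if e: "e \<in> A" "Suc (Suc (card e)) = Suc n" for e
  proof (cases "e \<in> B")
    case True
    have "cofaces X e = cofaces (A \<inter> B) e" using e by (auto simp: cofaces_def X_def)
    \<comment> \<open>A single coface would make \<open>e\<close> a boundary ridge of the interface,
      and the empty face lies below \<open>e\<close>.\<close>
    moreover have "card (cofaces (A \<inter> B) e) \<noteq> 1"
      using assms e True by (auto simp: bd_def boundary_ridges_def)
    moreover have "card (cofaces (A \<inter> B) e) \<le> 2"
      using pm_interface e True by (auto simp: pseudomanifold_def)
    moreover have "card (cofaces (A \<inter> B) e) \<ge> 1" using card_cofaces_pos[OF D, of e] e True by auto
    ultimately show ?thesis by (metis One_nat_def even_numeral le_antisym not_less_eq_eq numeral_2_eq_2)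
  next
    case False
    then have "cofaces X e = {}" using down_right by (auto simp: cofaces_def X_def)
    then show ?thesis by simp
  qed
  then have "X = {} \<or> X = boundary_ridges (Suc n) A"
    using interface_facets_subset by (intro boundary_ridges_connected[OF A pm_left]) (auto simp: X_def)
  moreover have "X \<noteq> {}"
    using abs_constructible_pure[OF D abs_constructible_empty[OF D]] by (auto simp: X_def)
  ultimately have "X = boundary_ridges (Suc n) A" by blast
  then show ?thesis unfolding X_def by (rule sym)
qed

text \<open>A closed interface would use up all boundary ridges of both parts. As its facets become
  interior ridges, the union would have no boundary.\<close>

lemma interface_has_boundary:
  assumes "{} \<in> bd (Suc n) (A \<union> B)"
  shows "{} \<in> bd n (A \<inter> B)"
proof (rule ccontr)
  assume no: "{} \<notin> bd n (A \<inter> B)"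
  obtain R where R: "R \<in> boundary_ridges (Suc n) (A \<union> B)" using assms by (auto simp: bd_def)
  then have "R \<in> A \<union> B" "R \<notin> A \<inter> B"
    using boundary_ridge_union_not_interface by (auto simp: boundary_ridges_def)
  then show False
    using R boundary_ridge_union_left boundary_ridge_union_right interface_closed[OF no]
      constructible_decomposition.interface_closed[OF swap] no by (auto simp: Int_commute)
qed

lemma decomposition_link:
  assumes F: "F \<in> A" "F \<in> B"
  shows "constructible_decomposition (n - card F) (link F A) (link F B)"
proof
  have "card F \<le> n" using abs_constructible_card_le[OF D] F by auto
  then have e: "Suc n - card F = Suc (n - card F)" by simp
  show "abs_constructible (Suc (n - card F)) (link F A)" "abs_constructible (Suc (n - card F)) (link F B)"
    using abs_constructible_link[OF A F(1)] abs_constructible_link[OF B F(2)] e by auto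
  show "abs_constructible (n - card F) (link F A \<inter> link F B)"
    using abs_constructible_link[OF D] F by (simp add: link_Int)
  show "pseudomanifold (Suc (n - card F)) (link F A \<union> link F B)"
    using pseudomanifold_link[OF union pm, of F] F e by (simp add: link_Un)
qed

text \<open>In the link of \<open>F\<close> the claim becomes \<open>interface_has_boundary\<close>
  for the induced decomposition. Together with \<open>bd_interface_subset\<close>, the boundary of
  the interface is its intersection with the boundary of the union.\<close>

lemma bd_Int_interface:
  assumes F: "F \<in> A" "F \<in> B" "F \<in> bd (Suc n) (A \<union> B)"
  shows "F \<in> bd n (A \<inter> B)"
proof -
  interpret L: constructible_decomposition "n - card F" "link F A" "link F B"
    using decomposition_link F by blast
  have "card F \<le> n" using abs_constructible_card_le[OF D] F by auto
  then have e: "Suc n - card F = Suc (n - card F)" by simp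
  have "{} \<in> bd (Suc (n - card F)) (link F A \<union> link F B)"
    using empty_in_bd_link[OF union, of F] F e by (simp add: link_Un)
  then have "{} \<in> bd (n - card F) (link F (A \<inter> B))"
    using L.interface_has_boundary by (simp add: link_Int)
  then show ?thesis using empty_in_bd_link[OF D, of F] F by simp
qed

end

section \<open>Collapsing a ball minus a facet onto its boundary\<close>

section \<open>Collapses\<close>

definition abs_collapse :: "'v set set \<Rightarrow> 'v set set \<Rightarrow> bool" where
  "abs_collapse K L \<longleftrightarrow> (\<exists>s S. s \<in> K \<and> S \<in> K \<and> s \<noteq> {} \<and> s \<subseteq> S \<and> card S = Suc (card s) \<and>
     (\<forall>T\<in>K. s \<subset> T \<longrightarrow> T = S) \<and> L = K - {s, S})"

lemma abs_collapseI:
  "s \<in> K \<Longrightarrow> S \<in> K \<Longrightarrow> s \<noteq> {} \<Longrightarrow> s \<subseteq> S \<Longrightarrow> card S = Suc (card s) \<Longrightarrow>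
    (\<And>T. T \<in> K \<Longrightarrow> s \<subset> T \<Longrightarrow> T = S) \<Longrightarrow> abs_collapse K (K - {s, S})"
  unfolding abs_collapse_def by blast

lemma abs_collapses_subset: "abs_collapse\<^sup>*\<^sup>* P Q \<Longrightarrow> Q \<subseteq> P"
  by (induction rule: rtranclp_induct) (auto simp: abs_collapse_def)

text \<open>A collapse can be carried out inside a larger complex if no removed face lies below an
  added one: free faces then stay free.\<close>

lemma abs_collapses_Un:
  assumes "abs_collapse\<^sup>*\<^sup>* P Q" "\<And>s T. s \<in> P \<Longrightarrow> s \<notin> Q \<Longrightarrow> T \<in> E \<Longrightarrow> \<not> s \<subseteq> T"
  shows "abs_collapse\<^sup>*\<^sup>* (P \<union> E) (Q \<union> E)"
  using assms
proof (induction rule: converse_rtranclp_induct)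
  case base
  then show ?case by simp
next
  case (step P P1)
  obtain s S where s: "s \<in> P" "S \<in> P" "s \<noteq> {}" "s \<subseteq> S" "card S = Suc (card s)"
    "\<And>T. T \<in> P \<Longrightarrow> s \<subset> T \<Longrightarrow> T = S" "P1 = P - {s, S}"
    using step.hyps(1) unfolding abs_collapse_def by blast
  have sub: "Q \<subseteq> P1" using step.hyps(2) by (rule abs_collapses_subset)
  then have n: "\<And>T. T \<in> E \<Longrightarrow> \<not> s \<subseteq> T" "S \<notin> E" using step.prems[of s] step.prems[of S] s by auto
  then have "P1 \<union> E = (P \<union> E) - {s, S}" using s by auto
  moreover have "abs_collapse (P \<union> E) ((P \<union> E) - {s, S})"
    using s n by (intro abs_collapseI) auto
  moreover have "abs_collapse\<^sup>*\<^sup>* (P1 \<union> E) (Q \<union> E)"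
    by (rule step.IH) (use step.prems s in auto)
  ultimately show ?case by (metis converse_rtranclp_into_rtranclp)
qed

text \<open>Deleting faces that survive the collapse only reduces the faces above a free
  face.\<close>

lemma abs_collapses_Diff:
  assumes "abs_collapse\<^sup>*\<^sup>* P Q" "X \<subseteq> Q"
  shows "abs_collapse\<^sup>*\<^sup>* (P - X) (Q - X)"
  using assms
proof (induction rule: converse_rtranclp_induct)
  case base
  then show ?case by simp
next
  case (step P P1)
  obtain s S where s: "s \<in> P" "S \<in> P" "s \<noteq> {}" "s \<subseteq> S" "card S = Suc (card s)"
    "\<And>T. T \<in> P \<Longrightarrow> s \<subset> T \<Longrightarrow> T = S" "P1 = P - {s, S}"
    using step.hyps(1) unfolding abs_collapse_def by blast
  have sub: "Q \<subseteq> P1" using step.hyps(2) by (rule abs_collapses_subset)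
  then have n: "s \<notin> X" "S \<notin> X" using step.prems s by auto
  have "P1 - X = (P - X) - {s, S}" using s by auto
  moreover have "abs_collapse (P - X) ((P - X) - {s, S})"
    using s n by (intro abs_collapseI) auto
  ultimately show ?case using step.IH step.prems by (metis converse_rtranclp_into_rtranclp)
qed

text \<open>First \<open>R\<close> is collapsed together with the unique facet \<open>F\<close>
  above it. The collapse of \<open>K - {F}\<close> onto the boundary never removes \<open>R\<close>,
  so it also works in the absence of \<open>R\<close>.\<close>

lemma abs_collapse_to_bd_minus_ridge:
  assumes K: "abs_constructible n K" and R: "R \<in> boundary_ridges n K" "R \<noteq> {}"
    and col: "\<And>F. F \<in> K \<Longrightarrow> card F = n \<Longrightarrow> abs_collapse\<^sup>*\<^sup>* (K - {F}) (bd n K)"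
  shows "abs_collapse\<^sup>*\<^sup>* K (bd n K - {R})"
proof -
  have r: "R \<in> K" "Suc (card R) = n" "card (cofaces K R) = 1" using R by (auto simp: boundary_ridges_def)
  obtain F where F: "cofaces K R = {F}" using r by (auto simp: card_1_singleton_iff)
  then have "F \<in> cofaces K R" by simp
  then have F': "F \<in> K" "R \<subseteq> F" "card F = Suc (card R)" by (auto simp: cofaces_def)
  have "T = F" if T: "T \<in> K" "R \<subset> T" for T
  proof -
    have "card R < card T" using T abs_constructible_finite_face[OF K] by (auto intro: psubset_card_mono)
    then have "card T = n" using abs_constructible_card_le[OF K T(1)] r by linarith
    then have "T \<in> cofaces K R" using T r by (auto simp: cofaces_def)
    then show ?thesis using F by auto
  qed
  then have "abs_collapse K (K - {R, F})" using r F' R by (intro abs_collapseI) auto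
  moreover have "abs_collapse\<^sup>*\<^sup>* (K - {F} - {R}) (bd n K - {R})"
    using col[of F] F' r R by (intro abs_collapses_Diff) (auto simp: bd_def)
  moreover have "K - {R, F} = K - {F} - {R}" by auto
  ultimately show ?thesis by (metis converse_rtranclp_into_rtranclp)
qed

lemma bd_subset: "abs_constructible n K \<Longrightarrow> bd n K \<subseteq> K"
  using down_closedD[OF abs_constructible_down_closed] by (fastforce simp: bd_def boundary_ridges_def)

lemma bd_card_le:
  assumes "abs_constructible n K" "F \<in> bd n K" shows "card F < n"
proof -
  obtain R where "R \<in> K" "F \<subseteq> R" "Suc (card R) = n" using assms by (auto simp: bd_def boundary_ridges_def)
  then have "card F \<le> card R" using abs_constructible_finite_face[OF assms(1)] card_mono by blast
  then show ?thesis using \<open>Suc (card R) = n\<close> by simp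
qed

lemma (in constructible_decomposition) collapse_step:
  assumes colA: "\<And>F. F \<in> A \<Longrightarrow> card F = Suc n \<Longrightarrow> abs_collapse\<^sup>*\<^sup>* (A - {F}) (bd (Suc n) A)"
    and colB: "\<And>F. F \<in> B \<Longrightarrow> card F = Suc n \<Longrightarrow> abs_collapse\<^sup>*\<^sup>* (B - {F}) (bd (Suc n) B)"
    and colD: "\<And>F. F \<in> A \<inter> B \<Longrightarrow> card F = n \<Longrightarrow> abs_collapse\<^sup>*\<^sup>* (A \<inter> B - {F}) (bd n (A \<inter> B))"
    and bdD: "{} \<in> bd n (A \<inter> B)"
    and F: "F \<in> A" "card F = Suc n"
  shows "abs_collapse\<^sup>*\<^sup>* (A \<union> B - {F}) (bd (Suc n) (A \<union> B))"
proof -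
  let ?bA = "bd (Suc n) A" and ?bB = "bd (Suc n) B" and ?bC = "bd (Suc n) (A \<union> B)" and ?bD = "bd n (A \<inter> B)"
  note DbB = constructible_decomposition.interface_subset_bd[OF swap, unfolded Int_commute[of B A]]
  note bA = bd_subset[OF A] and bB = bd_subset[OF B] and bC = bd_subset[OF union]
  have "F \<notin> B" using abs_constructible_card_le[OF D, of F] F by auto
  then have "A \<union> B - {F} = (A - {F}) \<union> B" by auto
  moreover have "abs_collapse\<^sup>*\<^sup>* ((A - {F}) \<union> B) (?bA \<union> B)"
    \<comment> \<open>A removed face below a face of \<open>B\<close> would lie in the interface,
      hence in the boundary of \<open>A\<close>, which is kept.\<close>
    by (rule abs_collapses_Un[OF colA[OF F]]) (use down_right interface_subset_bd in blast)
  ultimately have 1: "abs_collapse\<^sup>*\<^sup>* (A \<union> B - {F}) (?bA \<union> B)" by simp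
  have n: "n > 0" using bdD by (auto simp: bd_def boundary_ridges_def)
  obtain R where R: "R \<in> A \<inter> B" "card R = n"
    using abs_constructible_pure[OF D abs_constructible_empty[OF D]] by auto
  have RB: "R \<in> boundary_ridges (Suc n) B"
    using constructible_decomposition.interface_facets_subset[OF swap] R by auto
  have "R \<noteq> {}" using R n by auto
  then have "abs_collapse\<^sup>*\<^sup>* B (?bB - {R})" by (rule abs_collapse_to_bd_minus_ridge[OF B RB _ colB])
  \<comment> \<open>A removed face below a face of \<open>A\<close> lies in the interface, hence in
    the boundary of \<open>B\<close>, so it can only be \<open>R\<close>. No other face of the
    boundary of \<open>A\<close> contains \<open>R\<close>, as these have at most \<open>n\<close>
    vertices.\<close>
  then have "abs_collapse\<^sup>*\<^sup>* (B \<union> (?bA - {R})) ((?bB - {R}) \<union> (?bA - {R}))"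
  proof (rule abs_collapses_Un)
    fix s T assume s: "s \<in> B" "s \<notin> ?bB - {R}" and T: "T \<in> ?bA - {R}"
    show "\<not> s \<subseteq> T"
    proof
      assume "s \<subseteq> T"
      then have "s \<in> A" using T bA down_left by blast
      then have "s = R" using s DbB by auto
      moreover have "card T \<le> card R" using bd_card_le[OF A, of T] T R by auto
      moreover have "finite T" using T bA abs_constructible_finite_face[OF A] by auto
      ultimately have "T = R" using \<open>s \<subseteq> T\<close> card_seteq by blast
      then show False using T by auto
    qed
  qed
  moreover have "B \<union> (?bA - {R}) = ?bA \<union> B" using R by auto
  ultimately have 2: "abs_collapse\<^sup>*\<^sup>* (?bA \<union> B) ((?bB - {R}) \<union> (?bA - {R}))" by simp
  have Rn: "R \<notin> ?bC"
  proof
    assume "R \<in> ?bC"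
    then obtain R' where R': "R' \<in> boundary_ridges (Suc n) (A \<union> B)" "R \<subseteq> R'" by (auto simp: bd_def)
    then have "finite R'" "card R' = n"
      using abs_constructible_finite_face[OF union] by (auto simp: boundary_ridges_def)
    then have "R = R'" using R R' card_subset_eq by metis
    then show False using R R' boundary_ridge_union_not_interface by auto
  qed
  have up: "?bA \<union> ?bB \<subseteq> (A \<inter> B) \<union> ?bC"
  proof
    fix G assume "G \<in> ?bA \<union> ?bB"
    then obtain Q where Q: "Q \<in> boundary_ridges (Suc n) A \<or> Q \<in> boundary_ridges (Suc n) B" "G \<subseteq> Q"
      by (auto simp: bd_def)
    show "G \<in> (A \<inter> B) \<union> ?bC"
    proof (cases "Q \<in> A \<inter> B")
      case True
      then show ?thesis using Q down_left down_right by blast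
    next
      case False
      then have "Q \<in> boundary_ridges (Suc n) (A \<union> B)"
        using Q boundary_ridge_union_left[of Q] boundary_ridge_union_right[of Q]
        by (auto simp: boundary_ridges_def)
      then show ?thesis using Q by (auto simp: bd_def)
    qed
  qed
  have low: "?bC \<subseteq> ?bA \<union> ?bB"
  proof
    fix G assume "G \<in> ?bC"
    then obtain Q where Q: "Q \<in> boundary_ridges (Suc n) (A \<union> B)" "G \<subseteq> Q" by (auto simp: bd_def)
    moreover have "Q \<in> A \<union> B" using Q by (auto simp: boundary_ridges_def)
    ultimately show "G \<in> ?bA \<union> ?bB"
      using boundary_ridge_union_not_interface[OF Q(1)] boundary_ridge_union_left[of Q]
        boundary_ridge_union_right[of Q] by (auto simp: bd_def)
  qed
  \<comment> \<open>The two boundaries together consist of the interface and the boundary of the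
    union, so what is left to collapse is the interface without \<open>R\<close>.\<close>
  have "(?bB - {R}) \<union> (?bA - {R}) = (A \<inter> B - {R}) \<union> ?bC"
    using up low Rn interface_subset_bd DbB by auto
  moreover have "abs_collapse\<^sup>*\<^sup>* ((A \<inter> B - {R}) \<union> ?bC) (?bD \<union> ?bC)"
  proof (rule abs_collapses_Un[OF colD[OF R]])
    fix s T assume s: "s \<in> A \<inter> B - {R}" "s \<notin> ?bD" and T: "T \<in> ?bC"
    show "\<not> s \<subseteq> T"
    proof
      assume "s \<subseteq> T"
      then have "s \<in> ?bC" using T by (auto simp: bd_def)
      then show False using s bd_Int_interface by auto
    qed
  qed
  moreover have "?bD \<union> ?bC = ?bC" using bd_interface_subset by auto
  ultimately show ?thesis using 1 2 by (metis rtranclp_trans)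
qed

theorem abs_constructible_minus_facet_collapses_to_bd:
  assumes "abs_constructible n K" "pseudomanifold n K" "{} \<in> bd n K" "F \<in> K" "card F = n"
  shows "abs_collapse\<^sup>*\<^sup>* (K - {F}) (bd n K)"
  using assms
proof (induction arbitrary: F rule: abs_constructible.induct)
  case (abs_simplex S n)
  note S = abs_simplex(1,2)
  have F: "F = S" using abs_simplex card_subset_eq[of S F] by auto
  have c: "cofaces (Pow S) R = {S}" if "R \<subseteq> S" "Suc (card R) = n" for R
  proof -
    have "T = S" if "T \<subseteq> S" "card T = n" for T using card_subset_eq[of S T] that S by auto
    then show ?thesis using that S by (auto simp: cofaces_def)
  qed
  \<comment> \<open>For a simplex, removing the facet already leaves the boundary, with no collapse
    at all.\<close>
  have "bd n (Pow S) = Pow S - {S}"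
  proof (intro equalityI subsetI)
    fix G assume "G \<in> bd n (Pow S)"
    then show "G \<in> Pow S - {S}"
      using bd_subset[OF abs_constructible.abs_simplex[OF S]] bd_card_le[OF abs_constructible.abs_simplex[OF S]] S
      by fastforce
  next
    fix G assume G: "G \<in> Pow S - {S}"
    then obtain x where x: "x \<in> S" "x \<notin> G" by auto
    have r: "S - {x} \<subseteq> S" "Suc (card (S - {x})) = n" using S x card_Suc_Diff1[of S x] by auto
    then have "S - {x} \<in> boundary_ridges n (Pow S)" using c[OF r] by (auto simp: boundary_ridges_def)
    moreover have "G \<subseteq> S - {x}" using G x by auto
    ultimately show "G \<in> bd n (Pow S)" unfolding bd_def by blast
  qed
  then show ?case using F by simp
next
  case (abs_union n A B)
  interpret constructible_decomposition n A B
    using abs_union.hyps abs_union.prems(1) by unfold_locales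
  have bdD: "{} \<in> bd n (A \<inter> B)" using interface_has_boundary abs_union.prems(2) .
  \<comment> \<open>The interface contains the empty face and lies in both boundaries, so each
    induction hypothesis is available.\<close>
  then have "{} \<in> bd (Suc n) A" "{} \<in> bd (Suc n) B"
    using interface_subset_bd constructible_decomposition.interface_subset_bd[OF swap]
      abs_constructible_empty[OF A] abs_constructible_empty[OF B] by auto
  note IH = abs_union.IH(1)[OF pm_left this(1)] abs_union.IH(2)[OF pm_right this(2)]
    abs_union.IH(3)[OF pm_interface bdD]
  show ?case
  proof (cases "F \<in> A")
    case True
    then show ?thesis using collapse_step[OF IH bdD] abs_union.prems by blast
  next
    case False
    then have "F \<in> B" using abs_union.prems by blast
    then have "abs_collapse\<^sup>*\<^sup>* (B \<union> A - {F}) (bd (Suc n) (B \<union> A))"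
      using constructible_decomposition.collapse_step[OF swap, of F] IH bdD abs_union.prems(4)
      by (simp add: Int_commute)
    then show ?thesis by (simp add: Un_commute)
  qed
qed

section \<open>Euler characteristic, connectedness, and collapsing to a tree\<close>

section \<open>Collapsing the boundary\<close>

text \<open>The negative of the reduced Euler characteristic: exponents are dimension plus one and
  the empty face counts.\<close>

definition euler :: "'v set set \<Rightarrow> int" where
  "euler K = (\<Sum>F\<in>K. (-1) ^ card F)"

lemma euler_empty [simp]: "euler {} = 0"
  by (simp add: euler_def)

lemma euler_Un:
  "finite A \<Longrightarrow> finite B \<Longrightarrow> euler (A \<union> B) = euler A + euler B - euler (A \<inter> B)"
  unfolding euler_def using sum.union_inter[of A B "\<lambda>F. (-1::int) ^ card F"] by simp

text \<open>Faces cancel in pairs \<open>F\<close> and \<open>insert x F\<close>.\<close>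

lemma euler_Pow: "finite S \<Longrightarrow> S \<noteq> {} \<Longrightarrow> euler (Pow S) = 0"
proof (induction S rule: finite_induct)
  case (insert x S)
  have "euler (insert x ` Pow S) = (\<Sum>F\<in>Pow S. (-1) ^ card (insert x F))"
  proof -
    have "inj_on (insert x) (Pow S)"
      using insert(2) by (intro inj_onI) (metis PowD insert_ident subsetD)
    then show ?thesis unfolding euler_def by (subst sum.reindex) auto
  qed
  also have "\<dots> = (\<Sum>F\<in>Pow S. - ((-1) ^ card F))"
  proof (rule sum.cong[OF refl])
    fix F assume "F \<in> Pow S"
    then have "finite F" "x \<notin> F" using insert finite_subset by auto
    then show "(-1::int) ^ card (insert x F) = - ((-1) ^ card F)" by simp
  qed
  also have "\<dots> = - euler (Pow S)" by (simp add: euler_def sum_negf)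
  finally have "euler (insert x ` Pow S) = - euler (Pow S)" .
  moreover have "Pow S \<inter> insert x ` Pow S = {}" using insert by auto
  ultimately show ?case using insert(1) euler_Un[of "Pow S" "insert x ` Pow S"]
    by (simp add: Pow_insert)
qed simp

text \<open>Inclusion-exclusion, with both parts and the interface contributing 0. The boundary
  hypothesis excludes \<open>{{}}\<close>, whose value is 1.\<close>

lemma abs_constructible_euler:
  assumes "abs_constructible n K" "pseudomanifold n K" "{} \<in> bd n K"
  shows "euler K = 0"
  using assms
proof (induction rule: abs_constructible.induct)
  case (abs_simplex S n)
  then have "n > 0" by (auto simp: bd_def boundary_ridges_def)
  then have "S \<noteq> {}" using abs_simplex.hyps by auto
  then show ?case using abs_simplex.hyps(1) by (rule euler_Pow[rotated])
next
  case (abs_union n A B)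
  interpret constructible_decomposition n A B
    using abs_union.hyps abs_union.prems(1) by unfold_locales
  have bdD: "{} \<in> bd n (A \<inter> B)" using interface_has_boundary abs_union.prems(2) .
  then have "{} \<in> bd (Suc n) A" "{} \<in> bd (Suc n) B"
    using interface_subset_bd constructible_decomposition.interface_subset_bd[OF swap]
      abs_constructible_empty[OF A] abs_constructible_empty[OF B] by auto
  then show ?case
    using abs_union.IH(1)[OF pm_left] abs_union.IH(2)[OF pm_right] abs_union.IH(3)[OF pm_interface bdD]
      euler_Un[OF abs_constructible_finite[OF A] abs_constructible_finite[OF B]] by simp
qed

lemma abs_collapses_euler:
  "abs_collapse\<^sup>*\<^sup>* K L \<Longrightarrow> finite K \<Longrightarrow> euler L = euler K"
proof (induction rule: converse_rtranclp_induct)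
  case (step K K1)
  obtain s S where s: "s \<in> K" "S \<in> K" "card S = Suc (card s)" "K1 = K - {s, S}"
    using step.hyps(1) unfolding abs_collapse_def by blast
  then have "s \<noteq> S" by auto
  then have "euler {s, S} = 0" using s by (simp add: euler_def)
  moreover have "euler K = euler K1 + euler {s, S}"
    unfolding euler_def using s step.prems by (metis empty_subsetI insert_subset sum.subset_diff)
  ultimately show ?case using step s by simp
qed simp

definition vertex_connected :: "'v set set \<Rightarrow> bool" where
  "vertex_connected K \<longleftrightarrow> (\<forall>U. (\<forall>a b. {a, b} \<in> K \<longrightarrow> a \<in> U \<longrightarrow> b \<in> U) \<longrightarrow>
     (\<forall>v. {v} \<in> K \<longrightarrow> v \<in> U) \<or> (\<forall>v. {v} \<in> K \<longrightarrow> v \<notin> U))"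

lemma vertex_connectedD:
  assumes "vertex_connected K" "\<And>a b. {a, b} \<in> K \<Longrightarrow> a \<in> U \<Longrightarrow> b \<in> U" "{v} \<in> K" "v \<in> U" "{w} \<in> K"
  shows "w \<in> U"
  using assms unfolding vertex_connected_def by blast

text \<open>The bound on \<open>n\<close> ensures that the interface of a decomposition contains a
  vertex, through which the two parts are connected.\<close>

lemma abs_constructible_vertex_connected:
  "abs_constructible n K \<Longrightarrow> n \<ge> 2 \<Longrightarrow> vertex_connected K"
proof (induction rule: abs_constructible.induct)
  case (abs_simplex S n)
  then show ?case unfolding vertex_connected_def by auto
next
  case (abs_union n A B)
  obtain F where F: "F \<in> A \<inter> B" "card F = n"
    using abs_constructible_empty abs_constructible_pure abs_union.hyps(3) by blast
  then obtain x where "x \<in> F" using abs_union.prems by fastforce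
  then have x: "{x} \<in> A" "{x} \<in> B"
    using F down_closedD[OF abs_constructible_down_closed[OF abs_union.hyps(3)], of F "{x}"] by auto
  show ?case unfolding vertex_connected_def
  proof (intro allI impI)
    fix U assume U: "\<forall>a b. {a, b} \<in> A \<union> B \<longrightarrow> a \<in> U \<longrightarrow> b \<in> U"
    have "(\<forall>v. {v} \<in> A \<longrightarrow> v \<in> U) \<or> (\<forall>v. {v} \<in> A \<longrightarrow> v \<notin> U)"
      using abs_union.IH(1) abs_union.prems U unfolding vertex_connected_def by blast
    moreover have "(\<forall>v. {v} \<in> B \<longrightarrow> v \<in> U) \<or> (\<forall>v. {v} \<in> B \<longrightarrow> v \<notin> U)"
      using abs_union.IH(2) abs_union.prems U unfolding vertex_connected_def by blast
    ultimately show "(\<forall>v. {v} \<in> A \<union> B \<longrightarrow> v \<in> U) \<or> (\<forall>v. {v} \<in> A \<union> B \<longrightarrow> v \<notin> U)"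
      using x by blast
  qed
qed

lemma abs_collapse_down_closed:
  assumes "abs_collapse K L" "down_closed K"
  shows "down_closed L"
proof -
  obtain s S where s: "s \<in> K" "S \<in> K" "s \<subseteq> S" "card S = Suc (card s)" "L = K - {s, S}"
    "\<And>T. T \<in> K \<Longrightarrow> s \<subset> T \<Longrightarrow> T = S"
    using assms unfolding abs_collapse_def by blast
  show ?thesis unfolding down_closed_def
  proof (intro ballI allI impI)
    fix F G assume F: "F \<in> L" "G \<subseteq> F"
    have FK: "F \<in> K" "F \<noteq> s" "F \<noteq> S" using F(1) s(5) by auto
    have "F = S" if "s \<subset> F" using s(6)[OF FK(1) that] .
    then have "G \<noteq> s" using F(2) FK by blast
    moreover have "G \<noteq> S"
    proof
      assume "G = S"
      then have "s \<subset> F" using F(2) FK s(3) by blast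
      then show False using s(6) FK by blast
    qed
    moreover have "G \<in> K" using down_closedD[OF assms(2) FK(1) F(2)] .
    ultimately show "G \<in> L" using s(5) by simp
  qed
qed

lemma abs_collapse_vertex_connected:
  assumes "abs_collapse K L" "down_closed K" "\<And>F. F \<in> K \<Longrightarrow> finite F" "vertex_connected K"
  shows "vertex_connected L"
proof -
  obtain s S where s: "s \<in> K" "S \<in> K" "s \<noteq> {}" "s \<subseteq> S" "card S = Suc (card s)" "L = K - {s, S}"
    "\<And>T. T \<in> K \<Longrightarrow> s \<subset> T \<Longrightarrow> T = S"
    using assms unfolding abs_collapse_def by blast
  have fs: "finite s" "finite S" using assms(3) s by auto
  then obtain c where c: "c \<notin> s" "S = insert c s"
    using subset_codim1[of S s] s by blast
  show ?thesis unfolding vertex_connected_def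
  proof (intro allI impI)
    fix U assume U: "\<forall>a b. {a, b} \<in> L \<longrightarrow> a \<in> U \<longrightarrow> b \<in> U"
    show "(\<forall>v. {v} \<in> L \<longrightarrow> v \<in> U) \<or> (\<forall>v. {v} \<in> L \<longrightarrow> v \<notin> U)"
    proof (cases "card s = 1")
      case True
      then obtain v where v: "s = {v}" by (auto simp: card_1_singleton_iff)
      \<comment> \<open>The removed vertex \<open>v\<close> is classified like its only neighbour
        \<open>c\<close>, which extends \<open>U\<close> to an edge-closed set of the old
        complex.\<close>
      define U' where "U' = (if c \<in> U then insert v U else U - {v})"
      have vc: "v \<noteq> c" using c v by auto
      have cl: "b \<in> U'" if ab: "{a, b} \<in> K" "a \<in> U'" for a b
      proof (cases "v \<in> {a, b} \<and> a \<noteq> b")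
        case True
        then have "s \<subset> {a, b}" using v by auto
        then have "{a, b} = {c, v}" using s(7)[OF ab(1)] c v by auto
        then show ?thesis using ab(2) vc True by (auto simp: U'_def doubleton_eq_iff split: if_splits)
      next
        case False
        then have "a = b \<or> {a, b} \<in> L" "a = b \<or> a \<noteq> v \<and> b \<noteq> v" using ab s c v by auto
        then show ?thesis using ab(2) U by (auto simp: U'_def split: if_splits)
      qed
      have "(\<forall>w. {w} \<in> K \<longrightarrow> w \<in> U') \<or> (\<forall>w. {w} \<in> K \<longrightarrow> w \<notin> U')"
        using assms(4) cl unfolding vertex_connected_def by blast
      moreover have "{w} \<in> K \<and> w \<noteq> v" if "{w} \<in> L" for w using that s v by auto
      moreover have "w \<in> U' \<longleftrightarrow> w \<in> U" if "w \<noteq> v" for w using that by (auto simp: U'_def)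
      ultimately show ?thesis by metis
    next
      case False
      then have cs: "card s \<ge> 2" using s(3) fs card_0_eq[of s] by linarith
      have cl: "b \<in> U" if ab: "{a, b} \<in> K" "a \<in> U" for a b
      proof (cases "{a, b} \<in> L")
        case True
        then show ?thesis using ab U by auto
      next
        case False
        have "card {a, b} \<le> 2" by (simp add: card_insert_if)
        then have "{a, b} \<noteq> S" using cs s(5) by auto
        then have "s = {a, b}" using False ab s(6) by auto
        then have sab: "s = {a, b}" "a \<noteq> b" using cs by auto
        \<comment> \<open>A removed edge is bypassed through the third vertex \<open>c\<close> of
          the removed triangle.\<close>
        have "{a, c} \<in> K" "{c, b} \<in> K"
          using down_closedD[OF assms(2) s(2)] c sab by auto
        moreover have "{a, c} \<noteq> s" "{c, b} \<noteq> s" using sab c by auto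
        moreover have "{a, c} \<noteq> S" "{c, b} \<noteq> S" using sab c by auto
        ultimately have "{a, c} \<in> L" "{c, b} \<in> L" using s(6) by auto
        then show ?thesis using U ab by blast
      qed
      have "(\<forall>w. {w} \<in> K \<longrightarrow> w \<in> U) \<or> (\<forall>w. {w} \<in> K \<longrightarrow> w \<notin> U)"
        using assms(4) cl unfolding vertex_connected_def by blast
      then show ?thesis using s(6) by auto
    qed
  qed
qed

lemma abs_collapses_empty_face: "abs_collapse\<^sup>*\<^sup>* K L \<Longrightarrow> {} \<in> K \<Longrightarrow> {} \<in> L"
  by (induction rule: rtranclp_induct) (auto simp: abs_collapse_def)

lemma abs_collapses_invariants:
  assumes "abs_collapse\<^sup>*\<^sup>* K L" "down_closed K" "\<And>F. F \<in> K \<Longrightarrow> finite F" "vertex_connected K"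
  shows "down_closed L \<and> vertex_connected L"
proof -
  have "L \<subseteq> K \<and> down_closed L \<and> vertex_connected L"
    using assms
  proof (induction rule: rtranclp_induct)
    case (step L1 L2)
    then have "L1 \<subseteq> K" "down_closed L1" "vertex_connected L1" by auto
    moreover have "L2 \<subseteq> L1" using abs_collapses_subset[of L1 L2] step.hyps(2) by auto
    ultimately show ?case
      using abs_collapse_down_closed[OF step.hyps(2)] abs_collapse_vertex_connected[OF step.hyps(2)] step.prems
      by auto
  qed auto
  then show ?thesis by auto
qed

text \<open>Since \<open>euler\<close> also counts the empty face, its vanishing means one vertex more than edges; the degree sum
  then yields a leaf.\<close>

lemma tree_collapses:
  fixes P :: "'v set set"
  assumes "finite P" "down_closed P" "\<And>F. F \<in> P \<Longrightarrow> finite F \<and> card F \<le> 2"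
    "vertex_connected P" "euler P = 0" "{} \<in> P"
  shows "\<exists>v. abs_collapse\<^sup>*\<^sup>* P {{}, {v}}"
  using assms
proof (induction "card P" arbitrary: P rule: less_induct)
  case less
  define V where "V = {F \<in> P. card F = 1}"
  define E where "E = {F \<in> P. card F = 2}"
  have fin: "finite V" "finite E" using less.prems by (auto simp: V_def E_def)
  have "F = {} \<or> F \<in> V \<or> F \<in> E" if "F \<in> P" for F
  proof -
    have "finite F" "card F \<le> 2" using less.prems(3)[OF that] by auto
    then have "card F = 0 \<or> card F = 1 \<or> card F = 2" by linarith
    then show ?thesis using that \<open>finite F\<close> by (auto simp: V_def E_def)
  qed
  then have Pe: "P = {{}} \<union> (V \<union> E)" using less.prems(6) by (auto simp: V_def E_def)
  have dj: "{{}} \<inter> (V \<union> E) = {}" "V \<inter> E = {}" by (auto simp: V_def E_def)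
  have "euler P = euler {{} :: 'v set} + (euler V + euler E)"
    unfolding Pe using fin dj euler_Un[of "{{} :: 'v set}" "V \<union> E"] euler_Un[of V E] by simp
  moreover have "euler V = - int (card V)" by (simp add: euler_def V_def)
  moreover have "euler E = int (card E)" by (simp add: euler_def E_def)
  moreover have "euler {{} :: 'v set} = 1" by (simp add: euler_def)
  ultimately have VE: "card V = Suc (card E)" using less.prems(5) by simp
  show ?case
  proof (cases "card E = 0")
    case True
    then have "E = {}" "card V = 1" using VE fin by auto
    then obtain s where s: "V = {s}" by (auto simp: card_1_singleton_iff)
    then have "s \<in> V" by simp
    then obtain v where "s = {v}" by (auto simp: V_def card_1_singleton_iff)
    then have "P = {{}, {v}}" using Pe s \<open>E = {}\<close> by auto
    then show ?thesis by blast
  next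
    case False
    have deg: "(\<Sum>v\<in>V. card (cofaces P v)) = 2 * card E"
      using sum_vertex_degrees[OF less.prems(1,2)] by (simp add: V_def E_def)
    obtain v where v: "v \<in> V" "card (cofaces P v) < 2"
    proof (rule ccontr)
      assume "\<not> thesis"
      then have "\<And>v. v \<in> V \<Longrightarrow> 2 \<le> card (cofaces P v)" using that by (meson not_less)
      then have "(\<Sum>v\<in>V. 2) \<le> (\<Sum>v\<in>V. card (cofaces P v))" by (rule sum_mono)
      then show False using deg VE by simp
    qed
    obtain x where x: "v = {x}" "{x} \<in> P" using v by (auto simp: V_def card_1_singleton_iff)
    \<comment> \<open>An isolated vertex would be the only vertex by connectedness, while an edge
      exists and there are more vertices than edges.\<close>
    have "cofaces P v \<noteq> {}"
    proof
      assume none: "cofaces P v = {}"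
      have only: "w \<in> {x}" if "{w} \<in> P" for w
      proof (rule vertex_connectedD[OF less.prems(4) _ x(2) _ that])
        fix a b assume ab: "{a, b} \<in> P" "a \<in> {x}"
        show "b \<in> {x}"
        proof (rule ccontr)
          assume "b \<notin> {x}"
          then have "{a, b} \<in> cofaces P v" using ab x by (auto simp: cofaces_def)
          then show False using none by auto
        qed
      qed simp
      have "V \<subseteq> {v}"
      proof
        fix u assume "u \<in> V"
        then obtain w where "u = {w}" "{w} \<in> P" by (auto simp: V_def card_1_singleton_iff)
        then show "u \<in> {v}" using only[of w] x by simp
      qed
      then have "card V \<le> 1" using card_mono[of "{v}" V] by auto
      then show False using VE False by auto
    qed
    moreover have "finite (cofaces P v)" using less.prems(1) by (rule finite_cofaces)
    ultimately have "card (cofaces P v) = 1" using v(2)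
      by (metis One_nat_def card_0_eq less_2_cases)
    then obtain S where S: "cofaces P v = {S}" by (auto simp: card_1_singleton_iff)
    then have "S \<in> cofaces P v" by simp
    then have S': "S \<in> P" "v \<subseteq> S" "card S = Suc (card v)" by (auto simp: cofaces_def)
    have "T = S" if T: "T \<in> P" "v \<subset> T" for T
    proof -
      have "card v < card T" "card T \<le> 2" using T less.prems(3) by (auto intro: psubset_card_mono)
      then have "T \<in> cofaces P v" using T x by (auto simp: cofaces_def)
      then show ?thesis using S by auto
    qed
    then have col: "abs_collapse P (P - {v, S})" using x S' by (intro abs_collapseI) auto
    let ?P = "P - {v, S}"
    have "\<exists>w. abs_collapse\<^sup>*\<^sup>* ?P {{}, {w}}"
    proof (rule less.hyps)
      show "card ?P < card P" using x less.prems(1) by (intro psubset_card_mono) auto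
      show "finite ?P" using less.prems(1) by simp
      show "down_closed ?P" using abs_collapse_down_closed[OF col less.prems(2)] .
      show "\<And>F. F \<in> ?P \<Longrightarrow> finite F \<and> card F \<le> 2" using less.prems(3) by auto
      show "vertex_connected ?P" using abs_collapse_vertex_connected[OF col] less.prems by auto
      show "euler ?P = 0" using abs_collapses_euler[of P ?P] col less.prems by auto
      show "{} \<in> ?P" using less.prems(6) x S' by auto
    qed
    then show ?thesis using col by (metis converse_rtranclp_into_rtranclp)
  qed
qed

text \<open>The removed ridges always meet the remaining ones in a common face of codimension one, by connectedness
  of the boundary; that face is free.\<close>

lemma bd_collapses_codim2:
  assumes K: "abs_constructible n K" "pseudomanifold n K" "n > 2"
    and P: "P \<subseteq> bd n K" "down_closed P" "R \<in> boundary_ridges n K" "R \<notin> P"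
  shows "\<exists>Q. abs_collapse\<^sup>*\<^sup>* P Q \<and> (\<forall>F\<in>Q. Suc (card F) < n)"
  using P(1,2,4)
proof (induction "card P" arbitrary: P rule: less_induct)
  case less
  have finP: "finite P"
    using less.prems(1) bd_subset[OF K(1)] abs_constructible_finite[OF K(1)] finite_subset by metis
  define X where "X = P \<inter> boundary_ridges n K"
  have top: "F \<in> X" if F: "F \<in> P" "\<not> Suc (card F) < n" for F
  proof -
    obtain R where R: "R \<in> boundary_ridges n K" "F \<subseteq> R" using F(1) less.prems(1) unfolding bd_def by blast
    then have "finite R" "Suc (card R) = n" using abs_constructible_finite_face[OF K(1)] by (auto simp: boundary_ridges_def)
    then have "F = R" using R F by (intro card_seteq) auto
    then show ?thesis using R F by (simp add: X_def)
  qed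
  show ?case
  proof (cases "X = {}")
    case True
    then show ?thesis using top by (intro exI[of _ P]) auto
  next
    case False
    moreover have "X \<noteq> boundary_ridges n K" using P(3) less.prems(3) by (auto simp: X_def)
    \<comment> \<open>The remaining ridges are neither none nor all of the boundary ridges, since
      \<open>R\<close> is missing, so they do not form a cycle.\<close>
    ultimately obtain e where e: "e \<in> K" "Suc (Suc (card e)) = n" "odd (card (cofaces X e))"
      using boundary_ridges_connected[OF K(1,2), of X] by (auto simp: X_def)
    then have "cofaces X e \<noteq> {}" by (metis card.empty even_zero)
    then obtain t where t: "t \<in> X" "e \<subseteq> t" "card t = Suc (card e)" by (auto simp: cofaces_def)
    then obtain t' where t': "t' \<noteq> t" "{R \<in> boundary_ridges n K. e \<subseteq> R} = {t, t'}"
      using boundary_ridges_codim2_cases[OF K(1,2) e(2), of t] by (auto simp: X_def)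
    \<comment> \<open>Only two boundary ridges contain \<open>e\<close>; by parity just
      \<open>t\<close> remains, so \<open>e\<close> is free.\<close>
    have cX: "cofaces X e = {t, t'} \<inter> P"
      unfolding t'(2)[symmetric] cofaces_def X_def using e(2) by (auto simp: boundary_ridges_def)
    have "t' \<notin> P"
    proof
      assume "t' \<in> P"
      then have "cofaces X e = {t, t'}" using cX t by (auto simp: X_def)
      then show False using e(3) t'(1) by auto
    qed
    have tP: "t \<in> P" using t by (simp add: X_def)
    have "T = t" if T: "T \<in> P" "e \<subset> T" for T
    proof -
      have "T \<in> K" using T less.prems(1) bd_subset[OF K(1)] by auto
      then have "card e < card T" using T abs_constructible_finite_face[OF K(1)] by (auto intro: psubset_card_mono)
      then have "T \<in> X" using top[OF T(1)] e by linarith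
      then have "T \<in> {R \<in> boundary_ridges n K. e \<subseteq> R}" using T by (auto simp: X_def)
      then show ?thesis using t' T \<open>t' \<notin> P\<close> by auto
    qed
    moreover have e0: "e \<noteq> {}" using e K(3) by auto
    moreover have eP: "e \<in> P" using down_closedD[OF less.prems(2) tP t(2)] .
    ultimately have col: "abs_collapse P (P - {e, t})" using abs_collapseI[OF eP tP e0 t(2,3)] by blast
    have "\<exists>Q. abs_collapse\<^sup>*\<^sup>* (P - {e, t}) Q \<and> (\<forall>F\<in>Q. Suc (card F) < n)"
    proof (rule less.hyps)
      show "card (P - {e, t}) < card P" using finP tP by (intro psubset_card_mono) auto
      show "P - {e, t} \<subseteq> bd n K" "R \<notin> P - {e, t}" using less.prems by auto
      show "down_closed (P - {e, t})" using abs_collapse_down_closed[OF col less.prems(2)] .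
    qed
    then show ?thesis using col by (metis converse_rtranclp_into_rtranclp)
  qed
qed

text \<open>Collapses preserve connectedness and \<open>euler\<close>, so the graph left after the
  triangles inherits both from \<open>K\<close>.\<close>

theorem abs_constructible_3_ball_collapsible:
  assumes K: "abs_constructible 4 K" "pseudomanifold 4 K" "boundary_ridges 4 K \<noteq> {}"
  shows "\<exists>v. abs_collapse\<^sup>*\<^sup>* K {{}, {v}}"
proof -
  obtain R where R: "R \<in> boundary_ridges 4 K" using K by auto
  then have bd: "{} \<in> bd 4 K" and R3: "card R = 3" by (auto simp: bd_def boundary_ridges_def)
  have 1: "abs_collapse\<^sup>*\<^sup>* K (bd 4 K - {R})"
    using R3 abs_constructible_minus_facet_collapses_to_bd[OF K(1,2) bd]
    by (intro abs_collapse_to_bd_minus_ridge[OF K(1) R]) auto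
  have fin: "finite K" "\<And>F. F \<in> K \<Longrightarrow> finite F"
    using abs_constructible_finite[OF K(1)] abs_constructible_finite_face[OF K(1)] by auto
  have K': "down_closed K" "vertex_connected K" "euler K = 0"
    using abs_constructible_down_closed[OF K(1)] abs_constructible_vertex_connected[OF K(1)]
      abs_constructible_euler[OF K(1,2) bd] by auto
  have "down_closed (bd 4 K - {R})" using abs_collapses_invariants[OF 1 K'(1) fin(2) K'(2)] by simp
  then obtain Q where Q: "abs_collapse\<^sup>*\<^sup>* (bd 4 K - {R}) Q" "\<forall>F\<in>Q. Suc (card F) < 4"
    using bd_collapses_codim2[OF K(1,2), of "bd 4 K - {R}" R] R by auto
  have KQ: "abs_collapse\<^sup>*\<^sup>* K Q" using 1 Q(1) by (rule rtranclp_trans)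
  have QK: "Q \<subseteq> K" using abs_collapses_subset[OF KQ] .
  have e0: "euler Q = 0" using abs_collapses_euler[OF KQ fin(1)] K' by simp
  have "\<exists>v. abs_collapse\<^sup>*\<^sup>* Q {{}, {v}}"
  proof (rule tree_collapses)
    show "finite Q" using QK fin finite_subset by auto
    show "down_closed Q" "vertex_connected Q"
      using abs_collapses_invariants[OF KQ K'(1) fin(2) K'(2)] by auto
    show "finite F \<and> card F \<le> 2" if "F \<in> Q" for F using that Q(2) QK fin by fastforce
    show "euler Q = 0" by (rule e0)
    show "{} \<in> Q" using abs_collapses_empty_face[OF KQ abs_constructible_empty[OF K(1)]] .
  qed
  then show ?thesis using KQ by (metis rtranclp_trans)
qed

section \<open>Simplices encoded by their vertex sets\<close>

section \<open>From geometric to abstract complexes\<close>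

definition vertex_sets :: "'a::euclidean_space set set \<Rightarrow> 'a set set" where
  "vertex_sets C = {G. \<not> affine_dependent G \<and> convex hull G \<in> C}"

lemma convex_hull_affine_independent_face_iff:
  fixes G H :: "'a::euclidean_space set"
  assumes "\<not> affine_dependent G" "\<not> affine_dependent H"
  shows "convex hull G face_of convex hull H \<longleftrightarrow> G \<subseteq> H"
proof
  assume "convex hull G face_of convex hull H"
  then show "G \<subseteq> H"
    using assms by (metis extreme_point_of_convex_hull_affine_independent extreme_point_of_face subsetI)
next
  assume "G \<subseteq> H"
  then show "convex hull G face_of convex hull H"
    using assms(2) by (auto simp: face_of_convex_hull_affine_independent)
qed

lemma convex_hull_affine_independent_inject:
  fixes G H :: "'a::euclidean_space set"
  assumes "\<not> affine_dependent G" "\<not> affine_dependent H" "convex hull G = convex hull H"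
  shows "G = H"
proof -
  have "convex hull G face_of convex hull H" "convex hull H face_of convex hull G"
    unfolding assms(3) by (simp_all add: face_of_refl)
  then show ?thesis
    using convex_hull_affine_independent_face_iff[OF assms(1,2)]
      convex_hull_affine_independent_face_iff[OF assms(2,1)] by (simp add: subset_antisym)
qed

lemma aff_dim_simplex:
  fixes G :: "'a::euclidean_space set"
  assumes "\<not> affine_dependent G" shows "aff_dim (convex hull G) = int (card G) - 1"
  using aff_dim_affine_independent[OF assms] by (simp add: aff_dim_convex_hull)

lemma vertex_sets_faces:
  fixes V :: "'a::euclidean_space set"
  assumes "\<not> affine_dependent V"
  shows "vertex_sets {F. F face_of convex hull V} = Pow V"
proof (intro equalityI subsetI)
  fix G assume "G \<in> vertex_sets {F. F face_of convex hull V}"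
  then show "G \<in> Pow V"
    using convex_hull_affine_independent_face_iff[of G V] assms by (simp add: vertex_sets_def)
next
  fix G assume "G \<in> Pow V"
  then have "\<not> affine_dependent G" "G \<subseteq> V" using affine_independent_subset[OF assms] by simp_all
  then show "G \<in> vertex_sets {F. F face_of convex hull V}"
    using convex_hull_affine_independent_face_iff[of G V] assms by (simp add: vertex_sets_def)
qed

lemma abs_constructible_vertex_sets:
  assumes "constructible_dim d C"
  shows "d \<ge> -1 \<and> abs_constructible (nat (d + 1)) (vertex_sets C)"
  using assms
proof (induction rule: constructible_dim.induct)
  case (simplex d S)
  then obtain V where V: "\<not> affine_dependent V" "int (card V) = d + 1" "S = convex hull V"
    by (auto simp: simplex_def)
  then show ?case
    using abs_simplex[OF aff_independent_finite[OF V(1)], of "nat (d + 1)"] vertex_sets_faces[OF V(1)] by auto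
next
  case (union d C1 C2)
  \<comment> \<open>The induction hypothesis for the intersection says
    \<open>d - 1 \<ge> -1\<close>, so \<open>nat\<close> does not truncate.\<close>
  then have d: "d \<ge> 0" by simp
  then have e: "nat (d + 1) = Suc (nat d)" by simp
  have "vertex_sets (C1 \<union> C2) = vertex_sets C1 \<union> vertex_sets C2"
    "vertex_sets (C1 \<inter> C2) = vertex_sets C1 \<inter> vertex_sets C2" by (auto simp: vertex_sets_def)
  then show ?case using union.IH d unfolding e by (auto intro: abs_union)
qed

lemma simplicial_complex_eq_hulls:
  assumes "simplicial_complex C" shows "C = (hull) convex ` vertex_sets C"
proof (intro equalityI subsetI)
  fix S assume S: "S \<in> C"
  then obtain n where "n simplex S" using assms by (auto simp: simplicial_complex_def)
  then obtain V where "\<not> affine_dependent V" "S = convex hull V" by (auto simp: simplex_def)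
  then show "S \<in> (hull) convex ` vertex_sets C" using S by (auto simp: vertex_sets_def)
qed (auto simp: vertex_sets_def)

text \<open>The intersection is a face of both simplices, hence spanned by a subset of each vertex
  set. Affinely independent sets with equal hulls agree, so this is one subset of
  \<open>G \<inter> H\<close>.\<close>

lemma simplicial_complex_Int_hulls:
  assumes C: "simplicial_complex C" and G: "G \<in> vertex_sets C" "H \<in> vertex_sets C"
  shows "convex hull G \<inter> convex hull H = convex hull (G \<inter> H)"
proof
  have i: "\<not> affine_dependent G" "\<not> affine_dependent H" using G by (auto simp: vertex_sets_def)
  have f: "S \<in> C \<Longrightarrow> T \<in> C \<Longrightarrow> S \<inter> T face_of S" for S T
    using C by (auto simp: simplicial_complex_def)
  have "convex hull G \<inter> convex hull H face_of convex hull G"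
    "convex hull H \<inter> convex hull G face_of convex hull H"
    using f[of "convex hull G" "convex hull H"] f[of "convex hull H" "convex hull G"] G
    by (simp_all add: vertex_sets_def)
  then obtain c c' where c: "c \<subseteq> G" "convex hull G \<inter> convex hull H = convex hull c"
    "c' \<subseteq> H" "convex hull G \<inter> convex hull H = convex hull c'"
    using i by (auto simp: face_of_convex_hull_affine_independent Int_commute)
  then have "c = c'"
    using convex_hull_affine_independent_inject[OF affine_independent_subset[OF i(1) c(1)]
        affine_independent_subset[OF i(2) c(3)]] by simp
  then have "c \<subseteq> G \<inter> H" using c by auto
  then show "convex hull G \<inter> convex hull H \<subseteq> convex hull (G \<inter> H)" using c hull_mono by metis
qed (simp add: hull_mono)

lemma abs_collapse_imp_elementary_collapse:
  fixes K :: "'a::euclidean_space set set"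
  assumes "abs_collapse K L" "\<And>G. G \<in> K \<Longrightarrow> \<not> affine_dependent G"
  shows "elementary_collapse ((hull) convex ` K) ((hull) convex ` L)"
proof -
  obtain s S where s: "s \<in> K" "S \<in> K" "s \<noteq> {}" "s \<subseteq> S" "card S = Suc (card s)" "L = K - {s, S}"
    and free: "\<And>T. T \<in> K \<Longrightarrow> s \<subset> T \<Longrightarrow> T = S"
    using assms(1) unfolding abs_collapse_def by blast
  have inj: "inj_on ((hull) convex) K"
    by (rule inj_onI) (rule convex_hull_affine_independent_inject[OF assms(2) assms(2)])
  have 1: "(hull) convex ` L = (hull) convex ` K - {convex hull s, convex hull S}"
    using inj_on_image_set_diff[OF inj, of K "{s, S}"] s by simp
  have 2: "T = convex hull S"
    if T: "T \<in> (hull) convex ` K" "convex hull s face_of T" "convex hull s \<noteq> T" for T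
  proof -
    obtain G where G: "G \<in> K" "T = convex hull G" using T by auto
    then have "s \<subseteq> G" "s \<noteq> G"
      using T convex_hull_affine_independent_face_iff[of s G] assms(2) s by auto
    then show ?thesis using free G by blast
  qed
  have 3: "convex hull s face_of convex hull S"
    using s assms(2) convex_hull_affine_independent_face_iff[of s S] by auto
  have 4: "aff_dim (convex hull S) = aff_dim (convex hull s) + 1"
    using s assms(2) aff_dim_simplex[of s] aff_dim_simplex[of S] by auto
  have 5: "convex hull s \<noteq> {}" using s by simp
  have 6: "convex hull s \<in> (hull) convex ` K" "convex hull S \<in> (hull) convex ` K" using s by auto
  show ?thesis unfolding elementary_collapse_def
    by (rule exI[of _ "convex hull s"], rule exI[of _ "convex hull S"])
      (intro conjI ballI impI 1 3 4 5 6; elim conjE; rule 2)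
qed

lemma abs_collapses_imp_elementary_collapses:
  fixes K :: "'a::euclidean_space set set"
  assumes "abs_collapse\<^sup>*\<^sup>* K L" "\<And>G. G \<in> K \<Longrightarrow> \<not> affine_dependent G"
  shows "elementary_collapse\<^sup>*\<^sup>* ((hull) convex ` K) ((hull) convex ` L)"
  using assms(1)
proof (induction rule: rtranclp_induct)
  case (step L1 L2)
  have "\<not> affine_dependent G" if "G \<in> L1" for G
    using that assms(2) abs_collapses_subset[OF step.hyps(1)] by auto
  then show ?case
    using step.IH abs_collapse_imp_elementary_collapse[OF step.hyps(2)] by (metis rtranclp.rtrancl_into_rtrancl)
qed simp

section \<open>Consequences of invariance of domain\<close>

section \<open>Triangulated 3-balls\<close>

lemma interior_finite_Union_closed_empty:
  "finite \<F> \<Longrightarrow> (\<And>S. S \<in> \<F> \<Longrightarrow> closed S \<and> interior S = {}) \<Longrightarrow> interior (\<Union>\<F>) = {}"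
  by (induction \<F> rule: finite_induct) (auto simp: interior_closed_Un_empty_interior)

text \<open>The preimages of the hulls are finitely many closed sets covering a ball, so one of them
  contains an open ball, to which invariance of dimension applies.\<close>

lemma dim_le_covering_polytope:
  fixes f :: "'m::euclidean_space \<Rightarrow> 'a::euclidean_space"
  assumes f: "continuous_on (cball c r) f" "inj_on f (cball c r)" "r > 0"
    and G: "finite \<G>" "\<And>G. G \<in> \<G> \<Longrightarrow> finite G" "f ` cball c r \<subseteq> (\<Union>G\<in>\<G>. convex hull G)"
  shows "\<exists>G\<in>\<G>. int DIM('m) \<le> aff_dim (convex hull G)"
proof -
  define P where "P G = cball c r \<inter> f -` (convex hull G)" for G
  have "closed (P G)" if "G \<in> \<G>" for G
    unfolding P_def using f G(2)[OF that]
    by (intro continuous_closed_preimage) (auto intro: compact_imp_closed finite_imp_compact_convex_hull)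
  moreover have "interior (\<Union>(P ` \<G>)) \<noteq> {}"
  proof -
    have "\<Union>(P ` \<G>) = cball c r" using G(3) unfolding P_def by blast
    then show ?thesis using f(3) by simp
  qed
  ultimately obtain G where Gin: "G \<in> \<G>" "interior (P G) \<noteq> {}"
    using interior_finite_Union_closed_empty[of "P ` \<G>"] G(1) by auto
  then obtain x where "x \<in> interior (P G)" by auto
  then obtain e where e: "e > 0" "ball x e \<subseteq> P G" by (auto simp: mem_interior)
  have sub: "ball x e \<subseteq> cball c r" "f ` ball x e \<subseteq> convex hull G" using e by (auto simp: P_def)
  have "aff_dim (ball x e) \<le> aff_dim (convex hull G)"
  proof (rule invariance_of_dimension_convex_domain)
    show "continuous_on (ball x e) f" "inj_on f (ball x e)"
      using f sub(1) by (auto intro: continuous_on_subset inj_on_subset)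
    show "f \<in> ball x e \<rightarrow> affine hull (convex hull G)"
      using sub(2) hull_subset[of "convex hull G" affine] by auto
  qed simp
  then show ?thesis using Gin(1) e(1) by (auto simp: aff_dim_open)
qed

text \<open>The coordinate differences \<open>U\<close> form an affine relation among independent
  points.\<close>

lemma simplex_coordinates_unique:
  fixes r0 r1 r2 a :: "'a::euclidean_space"
  assumes "\<not> affine_dependent {a, r0, r1, r2}" "distinct [a, r0, r1, r2]"
    and "x0 + x1 + x2 + x3 = y0 + y1 + y2 + y3"
    and "x0 *\<^sub>R r0 + x1 *\<^sub>R r1 + x2 *\<^sub>R r2 + x3 *\<^sub>R a = y0 *\<^sub>R r0 + y1 *\<^sub>R r1 + y2 *\<^sub>R r2 + y3 *\<^sub>R a"
  shows "x0 = y0" "x1 = y1" "x2 = y2" "x3 = y3"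
proof -
  define U where "U v = (if v = a then x3 - y3 else if v = r0 then x0 - y0 else if v = r1 then x1 - y1 else x2 - y2)" for v
  have ne: "a \<noteq> r0" "a \<noteq> r1" "a \<noteq> r2" "r0 \<noteq> r1" "r0 \<noteq> r2" "r1 \<noteq> r2" using assms(2) by auto
  have "sum U {a, r0, r1, r2} = 0" using assms(3) by (simp add: U_def ne ne[symmetric])
  moreover have "(\<Sum>v\<in>{a, r0, r1, r2}. U v *\<^sub>R v) = 0"
    using assms(4) by (simp add: U_def ne ne[symmetric] algebra_simps)
  ultimately have "\<forall>v\<in>{a, r0, r1, r2}. U v = 0"
    using assms(1) affine_dependent_explicit_finite[of "{a, r0, r1, r2}"] by blast
  then show "x0 = y0" "x1 = y1" "x2 = y2" "x3 = y3" by (simp_all add: U_def ne ne[symmetric])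
qed

lemma convex_hull_4I:
  assumes "x0 \<ge> 0" "x1 \<ge> 0" "x2 \<ge> 0" "x3 \<ge> (0::real)" "x0 + x1 + x2 + x3 = 1"
  shows "x0 *\<^sub>R r0 + x1 *\<^sub>R r1 + x2 *\<^sub>R r2 + x3 *\<^sub>R a \<in> convex hull {a, r0, r1, r2}"
proof -
  define c where "c = (!) [x3, x0, x1, x2]"
  define v where "v = (!) [a, r0, r1, r2]"
  have i: "i = 0 \<or> i = 1 \<or> i = 2 \<or> i = 3" if "i \<in> {..<4}" for i :: nat using that by auto
  have s: "sum f {..<4} = f 0 + f 1 + f 2 + f 3" for f :: "nat \<Rightarrow> 'b::comm_monoid_add"
    by (simp add: eval_nat_numeral)
  have "(\<Sum>i<4. c i *\<^sub>R v i) \<in> convex hull {a, r0, r1, r2}"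
  proof (rule convex_sum)
    show "sum c {..<4} = 1" unfolding s using assms by (simp add: c_def eval_nat_numeral)
    show "0 \<le> c i" if "i \<in> {..<4}" for i using i[OF that] assms by (auto simp: c_def eval_nat_numeral)
    show "v i \<in> convex hull {a, r0, r1, r2}" if "i \<in> {..<4}" for i
      using i[OF that] by (auto simp: v_def hull_inc eval_nat_numeral)
  qed auto
  then show ?thesis unfolding s by (simp add: c_def v_def eval_nat_numeral add_ac)
qed

text \<open>Two tetrahedra glued along a triangle are parametrized by a piecewise linear map that bends
  3-space along the plane \<open>t = 0\<close>; invariance of domain applies to the composition with the
  embedding into 3-space.\<close>

lemma glued_tetrahedra_neighbourhood:
  fixes R :: "'a::euclidean_space set" and h :: "'a \<Rightarrow> real^3"
  assumes R: "card R = 3" "a \<notin> R" "b \<notin> R"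
    and ind: "\<not> affine_dependent (insert a R)" "\<not> affine_dependent (insert b R)"
    and int: "convex hull (insert a R) \<inter> convex hull (insert b R) = convex hull R"
    and h: "continuous_on (convex hull (insert a R) \<union> convex hull (insert b R)) h"
      "inj_on h (convex hull (insert a R) \<union> convex hull (insert b R))"
    and p: "p \<in> rel_interior (convex hull R)"
  shows "\<exists>N. open N \<and> h p \<in> N \<and> N \<subseteq> h ` (convex hull (insert a R) \<union> convex hull (insert b R))"
proof -
  obtain r0 r1 r2 where r: "R = {r0, r1, r2}" "r0 \<noteq> r1" "r0 \<noteq> r2" "r1 \<noteq> r2"
    using R(1) by (auto simp: card_3_iff)
  have da: "distinct [a, r0, r1, r2]" and db: "distinct [b, r0, r1, r2]" using R r by auto
  have ia: "\<not> affine_dependent {a, r0, r1, r2}" and ib: "\<not> affine_dependent {b, r0, r1, r2}"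
    using ind r by auto
  let ?F = "convex hull (insert a R) \<union> convex hull (insert b R)"
  \<comment> \<open>Barycentric coordinates in the tetrahedron with apex \<open>v\<close>: the
    entries of \<open>w\<close> are the weights of \<open>r1\<close>, \<open>r2\<close> and, up to
    sign, \<open>v\<close>; the point \<open>r0\<close> takes the rest.\<close>
  define c where "c w v = (1 - fst w - fst (snd w) - \<bar>snd (snd w)\<bar>) *\<^sub>R r0 + fst w *\<^sub>R r1
    + fst (snd w) *\<^sub>R r2 + \<bar>snd (snd w)\<bar> *\<^sub>R v" for w :: "real \<times> real \<times> real" and v :: 'a
  \<comment> \<open>The sign of the last coordinate selects the apex: \<open>a\<close> above the
    plane, \<open>b\<close> below.\<close>
  define \<psi> where "\<psi> w = (1 - fst w - fst (snd w) - \<bar>snd (snd w)\<bar>) *\<^sub>R r0 + fst w *\<^sub>R r1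
    + fst (snd w) *\<^sub>R r2 + max 0 (snd (snd w)) *\<^sub>R a + max 0 (- snd (snd w)) *\<^sub>R b"
    for w :: "real \<times> real \<times> real"
  define W where "W = {w :: real \<times> real \<times> real. 0 < fst w \<and> 0 < fst (snd w) \<and>
    fst w + fst (snd w) + \<bar>snd (snd w)\<bar> < 1}"
  have \<psi>a: "\<psi> w = c w a" if "snd (snd w) \<ge> 0" for w using that by (simp add: \<psi>_def c_def)
  have \<psi>b: "\<psi> w = c w b" if "snd (snd w) \<le> 0" for w using that by (simp add: \<psi>_def c_def)
  have cin: "c w v \<in> convex hull (insert v R)" if "w \<in> W" for w v
    unfolding c_def r(1) using that by (intro convex_hull_4I) (auto simp: W_def)
  have ceq: "fst w = fst w'" "fst (snd w) = fst (snd w')" "\<bar>snd (snd w)\<bar> = \<bar>snd (snd w')\<bar>"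
    if "c w v = c w' v" "\<not> affine_dependent {v, r0, r1, r2}" "distinct [v, r0, r1, r2]" for w w' v
    using simplex_coordinates_unique[OF that(2,3) _ that(1)[unfolded c_def]] by simp_all
  have cR: "snd (snd w) = 0" if w: "c w v \<in> convex hull R" "\<not> affine_dependent {v, r0, r1, r2}"
    "distinct [v, r0, r1, r2]" for w v
  proof -
    obtain x y z where "x + y + z = 1" "c w v = x *\<^sub>R r0 + y *\<^sub>R r1 + z *\<^sub>R r2"
      using w(1) unfolding r(1) convex_hull_3 by auto
    then show ?thesis
      using simplex_coordinates_unique(4)[OF w(2,3), of "1 - fst w - fst (snd w) - \<bar>snd (snd w)\<bar>"
          "fst w" "fst (snd w)" "\<bar>snd (snd w)\<bar>" x y z 0] unfolding c_def by simp
  qed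
  have "open W"
  proof -
    have "W = {w. 0 < fst w} \<inter> {w. 0 < fst (snd w)} \<inter> {w. fst w + fst (snd w) + \<bar>snd (snd w)\<bar> < 1}"
      by (auto simp: W_def)
    moreover have "open {w :: real \<times> real \<times> real. 0 < fst w}" "open {w :: real \<times> real \<times> real. 0 < fst (snd w)}"
      "open {w :: real \<times> real \<times> real. fst w + fst (snd w) + \<bar>snd (snd w)\<bar> < 1}"
      by (intro open_Collect_less continuous_intros)+
    ultimately show ?thesis by auto
  qed
  moreover have \<psi>W: "\<psi> ` W \<subseteq> ?F"
  proof (rule image_subsetI)
    fix w assume "w \<in> W"
    then show "\<psi> w \<in> ?F"
      using cin[of w a] cin[of w b] \<psi>a[of w] \<psi>b[of w] by (cases "snd (snd w) \<ge> 0") simp_all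
  qed
  moreover have "continuous_on W \<psi>" unfolding \<psi>_def by (intro continuous_intros)
  moreover have "inj_on \<psi> W"
  proof (rule inj_onI)
    \<comment> \<open>Points from opposite sides can only coincide in the common triangle, where the
      apex weight vanishes.\<close>
    have mixed: "w = w'" if w: "w \<in> W" "w' \<in> W" "\<psi> w = \<psi> w'" "snd (snd w) \<ge> 0" "snd (snd w') \<le> 0" for w w'
    proof -
      have "c w a = c w' b" using \<psi>a \<psi>b w by auto
      then have "c w a \<in> convex hull R" "c w' b \<in> convex hull R" using cin[of w a] cin[of w' b] w int by auto
      then have "snd (snd w) = 0" "snd (snd w') = 0" using cR ia ib da db by auto
      then have "c w a = c w' a" using \<open>c w a = c w' b\<close> by (simp add: c_def)
      then show ?thesis using ceq[of w a w'] ia da \<open>snd (snd w) = 0\<close> \<open>snd (snd w') = 0\<close>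
        by (simp add: prod_eq_iff)
    qed
    fix w w' assume w: "w \<in> W" "w' \<in> W" "\<psi> w = \<psi> w'"
    consider "snd (snd w) \<ge> 0" "snd (snd w') \<ge> 0" | "snd (snd w) \<le> 0" "snd (snd w') \<le> 0"
      | "snd (snd w) \<ge> 0" "snd (snd w') \<le> 0" | "snd (snd w) \<le> 0" "snd (snd w') \<ge> 0" by linarith
    then show "w = w'"
    proof cases
      case 1
      then show ?thesis using \<psi>a w(3) ceq[of w a w'] ia da by (simp add: prod_eq_iff)
    next
      case 2
      then show ?thesis using \<psi>b w(3) ceq[of w b w'] ib db by (simp add: prod_eq_iff)
    next
      case 3
      then show ?thesis using mixed[of w w'] w by simp
    next
      case 4
      then show ?thesis using mixed[of w' w] w by simp
    qed
  qed
  ultimately have "open ((h \<circ> \<psi>) ` W)"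
    using h by (intro invariance_of_domain_gen continuous_on_compose comp_inj_on)
      (auto intro: continuous_on_subset inj_on_subset)
  moreover have "p \<in> \<psi> ` W"
  proof -
    have "\<not> affine_dependent R" using ind(1) affine_independent_subset by blast
    then obtain u where u: "\<forall>x\<in>R. 0 < u x" "sum u R = 1" "(\<Sum>x\<in>R. u x *\<^sub>R x) = p"
      using p rel_interior_convex_hull_explicit[of R] by blast
    have s: "u r0 + u r1 + u r2 = 1" "u r0 *\<^sub>R r0 + u r1 *\<^sub>R r1 + u r2 *\<^sub>R r2 = p"
      using u(2,3) r by (simp_all add: add_ac)
    then have "u r0 = 1 - u r1 - u r2" by simp
    then have "\<psi> (u r1, u r2, 0) = p" using s(2) by (simp add: \<psi>_def)
    moreover have "(u r1, u r2, 0) \<in> W" using s(1) u(1) r by (auto simp: W_def)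
    ultimately show ?thesis by (metis image_eqI)
  qed
  ultimately show ?thesis
    using \<psi>W by (intro exI[of _ "(h \<circ> \<psi>) ` W"]) (auto simp: image_comp[symmetric])
qed

locale triangulated_3_ball =
  fixes C :: "'a::euclidean_space set set" and h :: "'a \<Rightarrow> real^3" and k :: "real^3 \<Rightarrow> 'a"
  assumes complex: "simplicial_complex C"
    and homeo: "homeomorphism (\<Union>C) (cball 0 1) h k"
begin

abbreviation "K \<equiv> vertex_sets C"

lemma face_indep: "G \<in> K \<Longrightarrow> \<not> affine_dependent G"
  and face_finite: "G \<in> K \<Longrightarrow> finite G"
  by (auto simp: vertex_sets_def aff_independent_finite)

lemma face_subset: "G \<in> K \<Longrightarrow> convex hull G \<subseteq> \<Union>C"
  by (auto simp: vertex_sets_def)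

lemma carrier_eq: "\<Union>C = (\<Union>G\<in>K. convex hull G)"
  by (subst simplicial_complex_eq_hulls[OF complex]) simp

lemma faces_finite: "finite K"
proof -
  have "inj_on ((hull) convex) K"
    by (rule inj_onI) (rule convex_hull_affine_independent_inject[OF face_indep face_indep])
  moreover have "finite ((hull) convex ` K)"
    using complex simplicial_complex_eq_hulls[OF complex] by (simp add: simplicial_complex_def)
  ultimately show ?thesis using finite_image_iff by blast
qed

lemma cont_h: "S \<subseteq> \<Union>C \<Longrightarrow> continuous_on S h"
  and inj_h: "S \<subseteq> \<Union>C \<Longrightarrow> inj_on h S"
  and h_image: "h ` \<Union>C = cball 0 1"
  using homeo by (auto simp: homeomorphism_def intro: continuous_on_subset inj_on_inverseI[where g = k] subsetD)

lemma cont_k: "S \<subseteq> cball 0 1 \<Longrightarrow> continuous_on S k"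
  and k_image: "k ` cball 0 1 = \<Union>C"
  and h_k: "x \<in> cball 0 1 \<Longrightarrow> h (k x) = x"
  using homeo by (auto simp: homeomorphism_def intro: continuous_on_subset)

lemma inj_k: "S \<subseteq> cball 0 1 \<Longrightarrow> inj_on k S"
  by (rule inj_on_inverseI[where g = h]) (blast intro: h_k)

lemma face_card_le: assumes "G \<in> K" shows "card G \<le> 4"
proof -
  have "aff_dim (convex hull G) \<le> aff_dim (UNIV :: (real^3) set)"
    using cont_h[OF face_subset] inj_h[OF face_subset] assms
    by (intro invariance_of_dimension_convex_domain[where f = h]) auto
  then show ?thesis using aff_dim_simplex[OF face_indep[OF assms]] by simp
qed

text \<open>Finitely many simplices of lower dimension cannot cover an embedded 3-ball.\<close>

lemma facet_exists: "\<exists>G\<in>K. card G \<ge> 4"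
proof -
  have "\<exists>G\<in>K. int DIM(real^3) \<le> aff_dim (convex hull G)"
    using cont_k[OF order_refl] inj_k[OF order_refl] faces_finite face_finite k_image carrier_eq
    by (intro dim_le_covering_polytope) auto
  then obtain G where "G \<in> K" "int DIM(real^3) \<le> aff_dim (convex hull G)" by blast
  then show ?thesis using aff_dim_simplex[OF face_indep, of G] by (intro bexI[of _ G]) simp_all
qed

lemma hull_coface_Int:
  assumes "insert a R \<in> K" "insert b R \<in> K" "a \<notin> R" "b \<notin> R" "a \<noteq> b"
  shows "convex hull (insert a R) \<inter> convex hull (insert b R) = convex hull R"
proof -
  have "insert a R \<inter> insert b R = R" using assms by auto
  then show ?thesis using simplicial_complex_Int_hulls[OF complex assms(1,2)] by simp
qed

lemma coface_insert:
  assumes "G \<in> cofaces K R" obtains a where "a \<notin> R" "G = insert a R" "G \<in> K"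
proof -
  have G: "G \<in> K" "R \<subseteq> G" "card G = Suc (card R)" using assms by (auto simp: cofaces_def)
  then obtain a where "a \<in> G" "R = G - {a}" using subset_codim1[OF face_finite] by blast
  then have "a \<notin> R" "G = insert a R" by auto
  then show ?thesis using that G(1) by blast
qed

lemma two_cofaces_neighbourhood:
  assumes "card R = 3" "G \<in> cofaces K R" "H \<in> cofaces K R" "G \<noteq> H"
    and p: "p \<in> rel_interior (convex hull R)"
  shows "\<exists>N. open N \<and> h p \<in> N \<and> N \<subseteq> h ` (convex hull G \<union> convex hull H)"
proof -
  obtain a where a: "a \<notin> R" "G = insert a R" "G \<in> K" using assms(2) by (rule coface_insert)
  obtain b where b: "b \<notin> R" "H = insert b R" "H \<in> K" using assms(3) by (rule coface_insert)
  have sub: "convex hull G \<union> convex hull H \<subseteq> \<Union>C" using face_subset a b by blast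
  show ?thesis unfolding a(2) b(2)
  proof (rule glued_tetrahedra_neighbourhood[OF assms(1) a(1) b(1) _ _ _ _ _ p])
    show "convex hull insert a R \<inter> convex hull insert b R = convex hull R"
      using a b assms(4) by (intro hull_coface_Int) auto
  qed (use face_indep a b cont_h[OF sub] inj_h[OF sub] in auto)
qed

text \<open>Two tetrahedra at \<open>R\<close> already fill a neighbourhood of \<open>h p\<close>. A
  third one would have interior points whose images lie there too, but such points belong to no
  other tetrahedron.\<close>

lemma pseudomanifold: "pseudomanifold 4 K"
  unfolding pseudomanifold_def
proof (intro ballI impI, rule ccontr)
  fix R assume R: "R \<in> K" "Suc (card R) = 4" "\<not> card (cofaces K R) \<le> 2"
  then have "3 \<le> card (cofaces K R)" by linarith
  then obtain T where T: "T \<subseteq> cofaces K R" "card T = 3" by (rule obtain_subset_with_card_n)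
  then obtain G1 G2 G3 where G: "T = {G1, G2, G3}" "G1 \<noteq> G2" "G1 \<noteq> G3" "G2 \<noteq> G3" by (auto simp: card_3_iff)
  have Gc: "G1 \<in> cofaces K R" "G2 \<in> cofaces K R" "G3 \<in> cofaces K R" using T G by auto
  then have GK: "G1 \<in> K" "G2 \<in> K" "G3 \<in> K" "R \<subseteq> G3"
    and cG: "card G1 = 4" "card G2 = 4" "card G3 = 4" using R(2) by (auto simp: cofaces_def)
  have "convex hull R \<noteq> {}" using R(2) by auto
  then obtain p where p: "p \<in> rel_interior (convex hull R)"
    using rel_interior_eq_empty[of "convex hull R"] by auto
  obtain N where N: "open N" "h p \<in> N" "N \<subseteq> h ` (convex hull G1 \<union> convex hull G2)"
    using two_cofaces_neighbourhood[OF _ Gc(1,2) G(2) p] R(2) by auto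
  let ?F = "convex hull G3"
  have pF: "p \<in> ?F" using p rel_interior_subset hull_mono[OF GK(4)] by blast
  have "openin (top_of_set ?F) (?F \<inter> h -` N)"
    using cont_h[OF face_subset[OF GK(3)]] N(1) by (rule continuous_openin_preimage_gen)
  then obtain U where U: "open U" "?F \<inter> h -` N = ?F \<inter> U" by (auto simp: openin_open)
  have "p \<in> closure (rel_interior ?F)"
    using convex_closure_rel_interior[of ?F] pF closure_subset by auto
  moreover have "p \<in> U" using U(2) pF N(2) by auto
  ultimately obtain q where q: "q \<in> rel_interior ?F" "q \<in> U"
    using U(1) open_Int_closure_eq_empty[of U "rel_interior ?F"] by blast
  have qF: "q \<in> ?F" using q rel_interior_subset by auto
  then have "h q \<in> N" using U(2) q by auto
  then obtain x where x: "x \<in> convex hull G1 \<union> convex hull G2" "h q = h x" using N(3) by blast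
  then have "x \<in> \<Union>C" "q \<in> \<Union>C" using face_subset GK qF by blast+
  then have "q = x" using x(2) inj_h[OF order_refl] by (auto dest: inj_onD)
  moreover have "q \<notin> convex hull H" if H: "H \<in> K" "card H = 4" "H \<noteq> G3" for H
  proof
    assume qH: "q \<in> convex hull H"
    have "convex hull (G3 \<inter> H) face_of ?F"
      using convex_hull_affine_independent_face_iff[of "G3 \<inter> H" G3]
        affine_independent_subset[of G3 "G3 \<inter> H"] face_indep[OF GK(3)] by auto
    moreover have "convex hull (G3 \<inter> H) \<noteq> ?F"
    proof
      assume eq: "convex hull (G3 \<inter> H) = ?F"
      have "G3 \<inter> H = G3"
        by (rule convex_hull_affine_independent_inject[OF affine_independent_subset[OF face_indep[OF GK(3)]]
              face_indep[OF GK(3)] eq]) simp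
      then have "G3 = H" using card_subset_eq[of H G3] face_finite[OF H(1)] H cG by auto
      then show False using H by simp
    qed
    ultimately have "convex hull (G3 \<inter> H) \<inter> rel_interior ?F = {}" by (rule face_of_disjoint_rel_interior)
    then show False
      using simplicial_complex_Int_hulls[OF complex GK(3) H(1)] qF qH q(1) by blast
  qed
  ultimately show False using x(1) GK cG G by blast
qed

text \<open>The face is the support \<open>G\<close> of the barycentric coordinates of
  \<open>x\<close>.\<close>

lemma in_rel_interior_face:
  assumes "x \<in> \<Union>C" "down_closed K" shows "\<exists>G\<in>K. x \<in> rel_interior (convex hull G)"
proof -
  obtain H where H: "H \<in> K" "x \<in> convex hull H" using assms carrier_eq by auto
  obtain u where u: "\<forall>v\<in>H. 0 \<le> u v" "sum u H = 1" "(\<Sum>v\<in>H. u v *\<^sub>R v) = x"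
    using H(2) convex_hull_finite[OF face_finite[OF H(1)]] by auto
  define G where "G = {v \<in> H. u v \<noteq> 0}"
  have G: "G \<in> K" using down_closedD[OF assms(2) H(1), of G] by (auto simp: G_def)
  have s1: "sum u G = sum u H"
    by (rule sum.mono_neutral_left) (use face_finite[OF H(1)] in \<open>auto simp: G_def\<close>)
  have sG: "(\<Sum>v\<in>G. u v *\<^sub>R v) = (\<Sum>v\<in>H. u v *\<^sub>R v)"
    by (rule sum.mono_neutral_left) (use face_finite[OF H(1)] in \<open>auto simp: G_def\<close>)
  have "sum u G = 1" using u(2) s1 by simp
  moreover have "(\<Sum>v\<in>G. u v *\<^sub>R v) = x" using u(3) sG by simp
  moreover have "\<forall>v\<in>G. 0 < u v" using u(1) by (force simp: G_def)
  ultimately have "x \<in> rel_interior (convex hull G)"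
    using rel_interior_convex_hull_explicit[OF face_indep[OF G]] by blast
  then show ?thesis using G by blast
qed

text \<open>Without boundary triangles, every point in the relative interior of a face of dimension at least 2
  would be an interior point of the ball, so the bounding sphere would be contained in a graph.\<close>

lemma boundary_ridges_nonempty:
  assumes "abs_constructible 4 K" shows "boundary_ridges 4 K \<noteq> {}"
proof
  assume no: "boundary_ridges 4 K = {}"
  define \<G> where "\<G> = {G \<in> K. card G \<le> 2}"
  \<comment> \<open>A point of the sphere is not interior to the ball, so no neighbourhood of it
    fits into the image of \<open>h\<close>.\<close>
  have not_open: False if "norm z = 1" "open N" "z \<in> N" "N \<subseteq> h ` S" "S \<subseteq> \<Union>C" for z N S
  proof -
    have "N \<subseteq> cball 0 1" using that h_image by blast
    then have "z \<in> interior (cball 0 1)" using that interiorI by blast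
    then show False using that(1) by simp
  qed
  have graph: "k z \<in> (\<Union>G\<in>\<G>. convex hull G)" if z: "norm z = 1" for z
  proof -
    have hz: "h (k z) = z" and "k z \<in> \<Union>C" using h_k k_image z by auto
    then obtain G where G: "G \<in> K" "k z \<in> rel_interior (convex hull G)"
      using in_rel_interior_face abs_constructible_down_closed[OF assms] by blast
    have "card G \<noteq> 4"
    proof
      assume c: "card G = 4"
      have sub: "rel_interior (convex hull G) \<subseteq> \<Union>C" using rel_interior_subset face_subset[OF G(1)] by blast
      have "openin (top_of_set UNIV) (h ` rel_interior (convex hull G))"
      proof (rule invariance_of_domain_affine_sets[OF openin_rel_interior _ _ _ cont_h[OF sub] _ inj_h[OF sub]])
        show "aff_dim (UNIV :: (real^3) set) \<le> aff_dim (affine hull (convex hull G))"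
          using aff_dim_affine_independent[OF face_indep[OF G(1)]] c by simp
      qed auto
      then show False using not_open[OF z, of "h ` rel_interior (convex hull G)"] G(2) sub hz by force
    qed
    moreover have "card G \<noteq> 3"
    proof
      assume c: "card G = 3"
      then have "card (cofaces K G) \<noteq> 1" using no G by (auto simp: boundary_ridges_def)
      moreover have "card (cofaces K G) \<ge> 1" using card_cofaces_pos[OF assms G(1)] c by simp
      ultimately have "2 \<le> card (cofaces K G)" by arith
      then obtain T where "T \<subseteq> cofaces K G" "card T = 2" by (rule obtain_subset_with_card_n)
      then obtain H1 H2 where H: "H1 \<in> cofaces K G" "H2 \<in> cofaces K G" "H1 \<noteq> H2" by (auto simp: card_2_iff)
      obtain N where N: "open N" "z \<in> N" "N \<subseteq> h ` (convex hull H1 \<union> convex hull H2)"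
        using two_cofaces_neighbourhood[OF c H G(2)] hz by auto
      have "H1 \<in> K" "H2 \<in> K" using H by (auto simp: cofaces_def)
      then show False using not_open[OF z N] face_subset by blast
    qed
    ultimately have "G \<in> \<G>" using face_card_le[OF G(1)] G(1) by (auto simp: \<G>_def)
    then show ?thesis using G(2) rel_interior_subset by blast
  qed
  \<comment> \<open>The closed unit disc is embedded as a hemisphere. Applying \<open>k\<close> puts
    a 2-disc inside the graph carried by \<open>\<G>\<close>, which
    \<open>dim_le_covering_polytope\<close> excludes.\<close>
  define g :: "real \<times> real \<Rightarrow> real^3" where
    "g w = fst w *\<^sub>R axis 1 1 + snd w *\<^sub>R axis 2 1 + sqrt (1 - (norm w)\<^sup>2) *\<^sub>R axis 3 1" for w
  have gi: "inner (g w) (axis 1 1) = fst w" "inner (g w) (axis 2 1) = snd w"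
    "inner (g w) (axis 3 1) = sqrt (1 - (norm w)\<^sup>2)" for w
    by (simp_all add: g_def inner_add_left inner_axis_axis)
  have gn: "norm (g w) = 1" if "w \<in> cball 0 1" for w
  proof -
    have "(norm w)\<^sup>2 \<le> 1" using that by (simp add: power_le_one)
    moreover have "(norm w)\<^sup>2 = (fst w)\<^sup>2 + (snd w)\<^sup>2" by (cases w) (simp add: norm_Pair)
    moreover have "inner (g w) (g w) = fst w * inner (g w) (axis 1 1) + snd w * inner (g w) (axis 2 1)
        + sqrt (1 - (norm w)\<^sup>2) * inner (g w) (axis 3 1)"
      by (subst (2) g_def) (simp add: inner_add_right)
    ultimately show ?thesis unfolding gi by (simp add: norm_eq_1 power2_eq_square)
  qed
  then have sub: "g ` cball 0 1 \<subseteq> cball 0 1" by auto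
  have "\<exists>G\<in>\<G>. int DIM(real \<times> real) \<le> aff_dim (convex hull G)"
  proof (rule dim_le_covering_polytope)
    show "continuous_on (cball 0 1) (k \<circ> g)"
      unfolding g_def[abs_def] using cont_k[OF sub]
      by (intro continuous_on_compose continuous_intros) (simp add: g_def[abs_def])
    have "inj_on g (cball 0 1)" using gi(1,2) by (intro inj_onI) (metis prod_eq_iff)
    then show "inj_on (k \<circ> g) (cball 0 1)" using inj_k[OF sub] by (intro comp_inj_on)
    show "(k \<circ> g) ` cball 0 1 \<subseteq> (\<Union>G\<in>\<G>. convex hull G)" using graph gn by auto
  qed (use faces_finite face_finite in \<open>auto simp: \<G>_def\<close>)
  then obtain G where "G \<in> K" "card G \<le> 2" "2 \<le> aff_dim (convex hull G)" by (auto simp: \<G>_def)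
  then show False using aff_dim_simplex[OF face_indep, of G] by simp
qed

end

theorem corollary3p14:
  fixes C :: "'a::euclidean_space set set"
  assumes "simplicial_3_ball C"
    and "constructible C"
  shows "collapsible C"
proof -
  obtain h k where hk: "simplicial_complex C" "homeomorphism (\<Union>C) (cball (0 :: real^3) 1) h k"
    using assms(1) by (auto simp: simplicial_3_ball_def homeomorphic_def)
  interpret triangulated_3_ball C h k using hk by unfold_locales
  obtain n where n: "abs_constructible n K"
    using assms(2) abs_constructible_vertex_sets unfolding constructible_def by blast
  obtain G where "G \<in> K" "card G = n"
    using abs_constructible_pure[OF n abs_constructible_empty[OF n]] by blast
  \<comment> \<open>The homeomorphism fixes the dimension: no face has more than four vertices, and
    some face has at least four.\<close>
  then have "n \<le> 4" using face_card_le by blast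
  moreover have "n \<ge> 4" using facet_exists abs_constructible_card_le[OF n] by (meson order_trans)
  ultimately have K4: "abs_constructible 4 K" using n by simp
  obtain v where "abs_collapse\<^sup>*\<^sup>* K {{}, {v}}"
    using abs_constructible_3_ball_collapsible[OF K4 pseudomanifold boundary_ridges_nonempty[OF K4]] by blast
  then have "elementary_collapse\<^sup>*\<^sup>* ((hull) convex ` K) ((hull) convex ` {{}, {v}})"
    using face_indep by (rule abs_collapses_imp_elementary_collapses)
  then show ?thesis
    unfolding collapsible_def by (auto simp flip: simplicial_complex_eq_hulls[OF hk(1)])
qed

end
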